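(* Let $\lambda>0$ and $n_1,n_2>0$ with $n_1+n_2=1$. The solution to the fractional relaxation equation $$n_1\frac{d^{1/2}\psi}{dt^{1/2}}+n_2\frac{d\psi}{dt}=-\lambda\psi,\qquad t>0,$$ with the initial condition $\psi(0)=1$, can be expressed as $$\psi_{\frac12,1}(t)=\Pr\left\{\mathcal{T}_{\frac12,1}(t)<U\right\},$$ where $U$ is an exponential random variable with parameter $\lambda$, and $\mathcal{T}_{\frac12,1}(t)$, $t>0$, is a random process independent of $U$ whose transition density is $$q_{\frac12,1}(y,t)=\frac{n_1\left(t-\frac{n_2}2y\right)}{\sqrt\pi}\,\frac{e^{-\frac{n_1^2y^2}{4(t-n_2y)}}}{\sqrt{(t-n_2y)^3}},\qquad t>0,\ 0<y<\frac t{n_2},$$ (and zero otherwise). Moreover $q_{\frac12,1}$ satisfies the fractional equation $$n_1\frac{\partial^{1/2}q}{\partial t^{1/2}}+n_2\frac{\partial q}{\partial t}=-\frac{\partial q}{\partial y},\qquad y,t>0,\qquad q(y,0)=\delta(y).$$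
   Context: $\frac{d^{1/2}}{dt^{1/2}}u(t)=\frac{1}{\Gamma(1/2)}\int_0^t(t-s)^{-1/2}u'(s)\,ds$ is the Caputo derivative of order $1/2$; $\frac{\partial^{1/2}}{\partial t^{1/2}}$ is the same operator acting in the variable $t$. "Transition density" means the one-dimensional density of $\mathcal{T}_{\frac12,1}(t)$ on $(0,\infty)$ at time $t$ (the process starts at $0$). $\delta$ is the Dirac delta at $0$; the condition $q(y,0)=\delta(y)$ means that $q(\cdot,t)$ tends to the unit mass at $0$ as $t\to0^+$. "Exponential with parameter $\lambda$" means density $\lambda e^{-\lambda y}$, $y>0$. *)

theory Defs
  imports "HOL-Probability.Probability"
begin

text \<open>Caputo derivative of order \<open>1/2\<close>, together with the condition under which the defining
  integral is meaningful: \<open>deriv\<close> and the Lebesgue integral are total functions, so differentiability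
  and absolute convergence have to be required separately.\<close>

definition caputo_half :: "(real \<Rightarrow> real) \<Rightarrow> real \<Rightarrow> real" where
  "caputo_half u t =
     1 / Gamma (1/2) * (LBINT s:{0<..<t}. (t - s) powr (-1/2) * deriv u s)"

definition caputo_half_exists :: "(real \<Rightarrow> real) \<Rightarrow> real \<Rightarrow> bool" where
  "caputo_half_exists u t \<longleftrightarrow>
     (\<forall>s\<in>{0<..<t}. u field_differentiable (at s)) \<and>
     set_integrable lborel {0<..<t} (\<lambda>s. (t - s) powr (-1/2) * deriv u s)"

text \<open>Only the values of \<open>\<psi>\<close> on \<open>[0,\<infinity>)\<close> matter. Continuity up to \<open>0\<close> ties the initial value to the
  equation, which is imposed for \<open>t > 0\<close> only.\<close>

definition relaxation_solution :: "real \<Rightarrow> real \<Rightarrow> real \<Rightarrow> (real \<Rightarrow> real) \<Rightarrow> bool" where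
  "relaxation_solution lam n1 n2 \<psi> \<longleftrightarrow>
     continuous_on {0..} \<psi> \<and> \<psi> 0 = 1 \<and>
     (\<forall>t>0. \<psi> field_differentiable (at t) \<and> caputo_half_exists \<psi> t \<and>
            n1 * caputo_half \<psi> t + n2 * deriv \<psi> t = - lam * \<psi> t)"

definition q_half_one :: "real \<Rightarrow> real \<Rightarrow> real \<Rightarrow> real \<Rightarrow> real" where
  "q_half_one n1 n2 y t =
     (if 0 < t \<and> 0 < y \<and> y < t / n2
      then n1 * (t - n2 / 2 * y) / sqrt pi
             * (exp (- (n1\<^sup>2 * y\<^sup>2 / (4 * (t - n2 * y)))) / sqrt ((t - n2 * y) ^ 3))
      else 0)"

text \<open>The process \<open>T\<close> is indexed by \<open>[0,\<infinity>)\<close>, starts at \<open>0\<close> and has the one-dimensional densities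
  \<open>q_half_one n1 n2 _ t\<close> at times \<open>t > 0\<close>; nothing is required of its other finite-dimensional
  distributions. Independence is that of the \<open>\<sigma>\<close>-algebras generated by the whole process and by \<open>U\<close>
  (\<open>indep_var\<close> would need both to have the same type).\<close>

definition relaxation_process ::
    "real \<Rightarrow> real \<Rightarrow> real \<Rightarrow> 'w measure \<Rightarrow> (real \<Rightarrow> 'w \<Rightarrow> real) \<Rightarrow> ('w \<Rightarrow> real) \<Rightarrow> bool" where
  "relaxation_process lam n1 n2 M T U \<longleftrightarrow>
     prob_space M \<and>
     distributed M lborel U (\<lambda>y. ennreal (exponential_density lam y)) \<and>
     (\<forall>t\<ge>0. T t \<in> borel_measurable M) \<and>
     (AE \<omega> in M. T 0 \<omega> = 0) \<and>
     (\<forall>t>0. distributed M lborel (T t) (\<lambda>y. ennreal (q_half_one n1 n2 y t))) \<and>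
     prob_space.indep_set M
       (sets (vimage_algebra (space M) (\<lambda>\<omega>. \<lambda>t\<in>{0..}. T t \<omega>) (PiM {0..} (\<lambda>_. borel))))
       (sets (vimage_algebra (space M) U borel))"

text \<open>Weak convergence to the unit mass at \<open>0\<close> as \<open>t \<rightarrow> 0+\<close>, along arbitrary sequences because
  \<^const>\<open>weak_conv_m\<close> is sequential.\<close>

definition delta_initial :: "(real \<Rightarrow> real \<Rightarrow> real) \<Rightarrow> bool" where
  "delta_initial q \<longleftrightarrow>
     (\<forall>\<tau> :: nat \<Rightarrow> real. (\<forall>k. 0 < \<tau> k) \<longrightarrow> \<tau> \<longlonglongrightarrow> 0 \<longrightarrow>
        weak_conv_m (\<lambda>k. density lborel (\<lambda>y. ennreal (q y (\<tau> k)))) (return borel 0))"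

end

theory Submission
  imports Defs
begin

text \<open>With \<open>a = n\<^sub>1 y / 2\<close> and \<open>r = t - n\<^sub>2 y\<close>, the density \<open>q\<close> is \<open>n\<^sub>1 g + n\<^sub>2 h\<close>, where \<open>h\<close> is the
  \<open>1/2\<close>-stable density \<open>a exp (-a\<^sup>2/r) / (sqrt pi r\<^sup>3\<^sup>/\<^sup>2)\<close> and \<open>g = exp (-a\<^sup>2/r) / sqrt (pi r)\<close>. The substitution
  \<open>1/s = 1/r + z\<^sup>2/a\<^sup>2\<close> turns Abel's half integral \<open>J\<close> of these kernels into Gaussian moments and gives
  \<open>J h = g\<close>, \<open>J h' = g'\<close>, \<open>J g' = h\<close>, from which the equation for \<open>q\<close> is an algebraic identity.

  If \<open>Z\<close> is half-normal, the solution \<open>y\<close> of \<open>n\<^sub>2 y + (n\<^sub>1 y / (2 Z))\<^sup>2 = t\<close> has density \<open>q(\<cdot>, t)\<close>. This realises the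
  process on one probability space, and as \<open>y\<close> is Lipschitz in \<open>t\<close>, \<open>\<psi>(t) = E exp (-\<lambda> y)\<close> may be
  differentiated under the expectation: \<open>\<psi>'(t) = -\<lambda> \<integral> exp (-\<lambda> y) h dy\<close>. By Tonelli and \<open>J h = g\<close>,
  \<open>n\<^sub>1 J \<psi>' + n\<^sub>2 \<psi>' = -\<lambda> \<integral> exp (-\<lambda> y) q dy = -\<lambda> \<psi>\<close>.

  For uniqueness, the absolute derivative of the difference of two solutions is dominated by its own
  convolution with \<open>A + B u\<^sup>-\<^sup>1\<^sup>/\<^sup>2\<close>, hence vanishes almost everywhere.\<close>

section \<open>Abel integrals of the heat kernels\<close>

text \<open>Substitution for absolutely integrable functions lives on the completed measure; Borel
  measurability of the truncated integrands identifies it with Bochner integrability over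
  \<open>lborel\<close>. Both directions are used: the Abel substitution passes from domain to
  image, the law of \<open>passage\<close> from image to domain.\<close>

lemma has_bochner_integral_change_of_variables:
  fixes f g g' :: "real \<Rightarrow> real"
  assumes S [measurable]: "S \<in> sets borel" and gS [measurable]: "g ` S \<in> sets borel"
    and der: "\<And>x. x \<in> S \<Longrightarrow> (g has_field_derivative g' x) (at x)"
    and inj: "inj_on g S"
    and f [measurable]: "f \<in> borel_measurable borel"
    and fg [measurable]: "(\<lambda>x. indicator S x * (\<bar>g' x\<bar> * f (g x))) \<in> borel_measurable borel"
  shows "has_bochner_integral lborel (\<lambda>x. indicator S x * (\<bar>g' x\<bar> * f (g x))) b \<longleftrightarrow>
         has_bochner_integral lborel (\<lambda>x. indicator (g ` S) x * f x) b"
proof -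
  have eq: "has_bochner_integral lborel (\<lambda>x. indicator A x * h x) b \<longleftrightarrow>
      h absolutely_integrable_on A \<and> integral A h = b"
    if "(\<lambda>x. indicator A x * h x) \<in> borel_measurable borel" for A :: "real set" and h :: "real \<Rightarrow> real"
  proof -
    have 1: "integrable lebesgue (\<lambda>x. indicator A x * h x) \<longleftrightarrow> integrable lborel (\<lambda>x. indicator A x * h x)"
      by (rule integrable_completion) (use that in simp)
    have 2: "integral A h = (LBINT x. indicator A x * h x)" if "set_integrable lborel A h"
      using set_borel_integral_eq_integral(2)[OF that] by (simp add: set_lebesgue_integral_def)
    show ?thesis
      using 1 2 by (auto simp: has_bochner_integral_iff set_integrable_def)
  qed
  have "(\<lambda>x. \<bar>g' x\<bar> * f (g x)) absolutely_integrable_on S \<and> integral S (\<lambda>x. \<bar>g' x\<bar> * f (g x)) = b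
     \<longleftrightarrow> f absolutely_integrable_on (g ` S) \<and> integral (g ` S) f = b"
    by (rule has_absolute_integral_change_of_variables_1')
      (use der inj S in \<open>auto intro: DERIV_subset\<close>)
  then show ?thesis
    by (subst (1 2) eq) auto
qed

text \<open>At \<open>x = 0\<close> both sides are 0 by the conventions for \<open>powr\<close> and
  division, so the endpoint is included.\<close>

lemma powr_minus_half: "x \<ge> 0 \<Longrightarrow> x powr (-1/2) = 1 / sqrt x" for x :: real
  by (cases "x = 0") (auto simp: powr_minus powr_half_sqrt[symmetric] field_simps)

text \<open>Under \<open>1/s = 1/r + z^2/a^2\<close> the exponential splits as
  \<open>exp (- a^2/r) * exp (- z^2)\<close>, and \<open>r - s = r * s * (z/a)^2\<close>. The Abel
  singularity thus becomes a factor \<open>1/z\<close>, cancelled by the Jacobian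
  \<open>2 * z * s^2 / a^2\<close>, and powers of \<open>1/s\<close> become polynomials in
  \<open>z^2\<close>.\<close>

lemma has_bochner_integral_abel_moment:
  fixes a r :: real
  assumes a: "a > 0" and r: "r > 0"
    and mom: "has_bochner_integral lborel
      (\<lambda>z. indicator {0<..} z * (exp (-z\<^sup>2) * (1 / r + z\<^sup>2 / a\<^sup>2) ^ m)) b"
  shows "has_bochner_integral lborel
     (\<lambda>s. indicator {0<..<r} s *
        ((r - s) powr (-1/2) * ((1 / s) ^ m / (s * sqrt s) * exp (- a\<^sup>2 / s))))
     (2 / (a * sqrt r) * exp (- a\<^sup>2 / r) * b)"
proof -
  define g where "g z = 1 / (1 / r + z\<^sup>2 / a\<^sup>2)" for z :: real
  define f where "f s = (r - s) powr (-1/2) * ((1 / s) ^ m / (s * sqrt s) * exp (- a\<^sup>2 / s))" for s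
  define g' where "g' z = - (2 * z / a\<^sup>2) * (g z)\<^sup>2" for z
  have pos: "1 / r + z\<^sup>2 / a\<^sup>2 > 0" for z :: real
    using r by (intro add_pos_nonneg) auto
  have gpos: "g z > 0" for z using pos by (simp add: g_def)
  have der: "(g has_field_derivative g' z) (at z)" for z
    unfolding g_def[abs_def] g'_def
    using a pos[of z] by (auto intro!: derivative_eq_intros simp: power2_eq_square)
  have inv: "z = a * sqrt (1 / g z - 1 / r)" if "z > 0" for z
  proof -
    have "1 / g z - 1 / r = (z / a)\<^sup>2" by (simp add: g_def power_divide)
    then show ?thesis using a that by simp
  qed
  have inj: "inj_on g {0<..}"
    by (rule inj_onI) (metis inv greaterThan_iff)
  have img: "g ` {0<..} = {0<..<r}"
  proof safe
    fix z :: real assume "z > 0"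
    then have "1 / r + z\<^sup>2 / a\<^sup>2 > 1 / r" using a by simp
    then have "1 / (1 / r + z\<^sup>2 / a\<^sup>2) < 1 / (1 / r)"
      using r pos[of z] by (intro divide_strict_left_mono) auto
    then show "g z \<in> {0<..<r}" using gpos[of z] by (simp add: g_def)
  next
    fix s assume s: "s \<in> {0<..<r}"
    then have p: "1 / s - 1 / r > 0" using r by (simp add: field_simps)
    then have "g (a * sqrt (1 / s - 1 / r)) = s"
      using s a by (simp add: g_def power_mult_distrib)
    then show "s \<in> g ` {0<..}" using p a by (intro image_eqI[of _ _ "a * sqrt (1 / s - 1 / r)"]) auto
  qed
  have [measurable]: "f \<in> borel_measurable borel" "g \<in> borel_measurable borel"
      "g' \<in> borel_measurable borel"
    unfolding f_def[abs_def] g_def[abs_def] g'_def[abs_def] by measurable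
  have val: "\<bar>g' z\<bar> * f (g z) = 2 / (a * sqrt r) * exp (- a\<^sup>2 / r) * (exp (-z\<^sup>2) * (1 / r + z\<^sup>2 / a\<^sup>2) ^ m)"
    if z: "z > 0" for z
  proof -
    have gr: "g z < r" using img z by (auto simp: set_eq_iff image_iff)
    have ginv: "1 / g z = 1 / r + z\<^sup>2 / a\<^sup>2" by (simp add: g_def)
    have "r - g z = r * g z * (1 / g z - 1 / r)"
      using gpos[of z] r by (simp add: field_simps)
    also have "\<dots> = (r * g z) * (z / a)\<^sup>2" by (simp add: ginv power_divide)
    finally have "sqrt (r - g z) = sqrt r * sqrt (g z) * (z / a)"
      using z a by (simp add: real_sqrt_mult)
    then have p: "(r - g z) powr (-1/2) = 1 / (sqrt r * sqrt (g z) * (z / a))"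
      using powr_minus_half[of "r - g z"] gr by simp
    have e: "exp (- a\<^sup>2 / g z) = exp (- a\<^sup>2 / r) * exp (- z\<^sup>2)"
    proof -
      have "- a\<^sup>2 / g z = - a\<^sup>2 * (1 / g z)" by simp
      also have "\<dots> = - a\<^sup>2 / r + - z\<^sup>2" using a by (simp add: ginv field_simps)
      finally show ?thesis by (simp only: exp_add)
    qed
    have ab: "\<bar>g' z\<bar> = 2 * z / a\<^sup>2 * (g z)\<^sup>2" using z by (simp add: g'_def abs_mult)
    have sq: "sqrt (g z) * sqrt (g z) = g z" using gpos[of z] by simp
    have sg: "sqrt (g z) > 0" using gpos[of z] by simp
    have "\<bar>g' z\<bar> * f (g z) = 2 * z / a\<^sup>2 * (g z)\<^sup>2 * (1 / (sqrt r * sqrt (g z) * (z / a))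
        * ((1 / g z) ^ m / (g z * sqrt (g z)) * (exp (- a\<^sup>2 / r) * exp (- z\<^sup>2))))"
      by (simp only: ab f_def p e)
    also have "\<dots> = 2 / (a * sqrt r) * exp (- a\<^sup>2 / r) * (exp (-z\<^sup>2) * (1 / g z) ^ m)
        * ((g z) / (sqrt (g z) * sqrt (g z)))"
      using z a sg gpos[of z] r by (simp add: divide_simps power2_eq_square)
    also have "\<dots> = 2 / (a * sqrt r) * exp (- a\<^sup>2 / r) * (exp (-z\<^sup>2) * (1 / r + z\<^sup>2 / a\<^sup>2) ^ m)"
      unfolding sq ginv using gpos[of z] by simp
    finally show ?thesis .
  qed
  have "has_bochner_integral lborel (\<lambda>z. indicator {0<..} z * (\<bar>g' z\<bar> * f (g z)))
      (2 / (a * sqrt r) * exp (- a\<^sup>2 / r) * b)"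
  proof -
    have "has_bochner_integral lborel (\<lambda>z. 2 / (a * sqrt r) * exp (- a\<^sup>2 / r) *
       (indicator {0<..} z * (exp (-z\<^sup>2) * (1 / r + z\<^sup>2 / a\<^sup>2) ^ m))) (2 / (a * sqrt r) * exp (- a\<^sup>2 / r) * b)"
      by (intro has_bochner_integral_mult_right mom)
    also have "(\<lambda>z. 2 / (a * sqrt r) * exp (- a\<^sup>2 / r) *
       (indicator {0<..} z * (exp (-z\<^sup>2) * (1 / r + z\<^sup>2 / a\<^sup>2) ^ m)))
       = (\<lambda>z. indicator {0<..} z * (\<bar>g' z\<bar> * f (g z)))"
      by (auto simp: val indicator_def)
    finally show ?thesis .
  qed
  then have "has_bochner_integral lborel (\<lambda>x. indicator (g ` {0<..}) x * f x)
      (2 / (a * sqrt r) * exp (- a\<^sup>2 / r) * b)"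
    by (subst has_bochner_integral_change_of_variables[symmetric, where g' = g'])
      (auto intro: der inj simp: img)
  then show ?thesis by (simp add: img f_def[abs_def])
qed

lemma half_gaussian_moment:
  "has_bochner_integral lborel (\<lambda>z::real. indicator {0<..} z * (exp (-z\<^sup>2) * z ^ (2 * m)))
     (sqrt pi / 2 * (fact (2 * m) / (2 ^ (2 * m) * fact m)))"
  using gaussian_moment_even_pos[of m]
  by (rule has_bochner_integral_cong_AE[THEN iffD1, rotated 3])
    (auto intro!: AE_I[of _ _ "{0}"] simp: indicator_def)

section \<open>The four kernels and their half integrals\<close>

text \<open>For \<open>a > 0\<close> the Laplace transform in \<open>s\<close>, with variable
  \<open>p\<close>, is \<open>exp (-2 * a * sqrt p) / sqrt p\<close>; that of
  \<open>levy_density a\<close> is \<open>exp (-2 * a * sqrt p)\<close>. Half integration divides by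
  \<open>sqrt p\<close> and differentiation multiplies by \<open>p\<close>, which predicts the three
  Abel identities below. The extension by zero is smooth because \<open>exp (- a^2/s)\<close> is
  flat at 0.\<close>

definition abel_gauss :: "real \<Rightarrow> real \<Rightarrow> real" where
  "abel_gauss a s = (if 0 < s then exp (- a\<^sup>2 / s) / (sqrt pi * sqrt s) else 0)"

definition levy_density :: "real \<Rightarrow> real \<Rightarrow> real" where
  "levy_density a s = (if 0 < s then a * exp (- a\<^sup>2 / s) / (sqrt pi * (s * sqrt s)) else 0)"

text \<open>Written as logarithmic derivative in \<open>s\<close> times the kernel, so that the
  cutoff at \<open>s = 0\<close> is inherited; \<open>levy_density'\<close> is encoded in the same
  way.\<close>

definition abel_gauss' :: "real \<Rightarrow> real \<Rightarrow> real" where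
  "abel_gauss' a s = (a\<^sup>2 / s\<^sup>2 - 1 / (2 * s)) * abel_gauss a s"

definition levy_density' :: "real \<Rightarrow> real \<Rightarrow> real" where
  "levy_density' a s = (a\<^sup>2 / s\<^sup>2 - 3 / (2 * s)) * levy_density a s"

lemma measurable_kernels [measurable]:
  "(\<lambda>x. abel_gauss (f x) (g x)) \<in> borel_measurable M"
  "(\<lambda>x. levy_density (f x) (g x)) \<in> borel_measurable M"
  "(\<lambda>x. abel_gauss' (f x) (g x)) \<in> borel_measurable M"
  "(\<lambda>x. levy_density' (f x) (g x)) \<in> borel_measurable M"
  if [measurable]: "f \<in> borel_measurable M" "g \<in> borel_measurable M"
  unfolding abel_gauss_def levy_density_def abel_gauss'_def levy_density'_def by measurable

context
  fixes a r :: real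
  assumes a: "a > 0" and r: "r > 0"
begin

text \<open>The cases \<open>m = 0, 1, 2\<close> of the substitution: the power is expanded and
  integrated termwise. Relative to \<open>sqrt pi / 2\<close>, the half-line Gaussian moments of
  \<open>z^0\<close>, \<open>z^2\<close>, \<open>z^4\<close> are 1, 1/2, 3/4.\<close>

private lemma moment0: "has_bochner_integral lborel
     (\<lambda>s. indicator {0<..<r} s * ((r - s) powr (-1/2) * (1 / (s * sqrt s) * exp (- a\<^sup>2 / s))))
     (2 / (a * sqrt r) * exp (- a\<^sup>2 / r) * (sqrt pi / 2))"
  using has_bochner_integral_abel_moment[OF a r, of 0 "sqrt pi / 2"] half_gaussian_moment[of 0] by simp

private lemma moment1: "has_bochner_integral lborel
     (\<lambda>s. indicator {0<..<r} s * ((r - s) powr (-1/2) * ((1 / s) / (s * sqrt s) * exp (- a\<^sup>2 / s))))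
     (2 / (a * sqrt r) * exp (- a\<^sup>2 / r) * (sqrt pi / 2 * (1 / r + 1 / (2 * a\<^sup>2))))"
proof -
  have "has_bochner_integral lborel
      (\<lambda>z. 1 / r * (indicator {0<..} z * (exp (-z\<^sup>2) * z ^ (2 * 0)))
         + 1 / a\<^sup>2 * (indicator {0<..} z * (exp (-z\<^sup>2) * z ^ (2 * 1))))
      (1 / r * (sqrt pi / 2 * (fact (2 * 0) / (2 ^ (2 * 0) * fact 0)))
         + 1 / a\<^sup>2 * (sqrt pi / 2 * (fact (2 * 1) / (2 ^ (2 * 1) * fact 1))))"
    by (intro has_bochner_integral_add has_bochner_integral_mult_right half_gaussian_moment)
  then have "has_bochner_integral lborel
      (\<lambda>z. indicator {0<..} z * (exp (-z\<^sup>2) * (1 / r + z\<^sup>2 / a\<^sup>2) ^ 1))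
      (sqrt pi / 2 * (1 / r + 1 / (2 * a\<^sup>2)))"
    by (rule arg_cong2[where f = "has_bochner_integral lborel", THEN iffD1, rotated 2])
      (auto simp: field_simps power2_eq_square fun_eq_iff)
  from has_bochner_integral_abel_moment[OF a r this] show ?thesis by simp
qed

private lemma moment2: "has_bochner_integral lborel
     (\<lambda>s. indicator {0<..<r} s * ((r - s) powr (-1/2) * ((1 / s)\<^sup>2 / (s * sqrt s) * exp (- a\<^sup>2 / s))))
     (2 / (a * sqrt r) * exp (- a\<^sup>2 / r) *
        (sqrt pi / 2 * (1 / r\<^sup>2 + 1 / (r * a\<^sup>2) + 3 / (4 * a ^ 4))))"
proof -
  have "has_bochner_integral lborel
      (\<lambda>z. 1 / r\<^sup>2 * (indicator {0<..} z * (exp (-z\<^sup>2) * z ^ (2 * 0)))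
         + 2 / (r * a\<^sup>2) * (indicator {0<..} z * (exp (-z\<^sup>2) * z ^ (2 * 1)))
         + 1 / a ^ 4 * (indicator {0<..} z * (exp (-z\<^sup>2) * z ^ (2 * 2))))
      (1 / r\<^sup>2 * (sqrt pi / 2 * (fact (2 * 0) / (2 ^ (2 * 0) * fact 0)))
         + 2 / (r * a\<^sup>2) * (sqrt pi / 2 * (fact (2 * 1) / (2 ^ (2 * 1) * fact 1)))
         + 1 / a ^ 4 * (sqrt pi / 2 * (fact (2 * 2) / (2 ^ (2 * 2) * fact 2))))"
    by (intro has_bochner_integral_add has_bochner_integral_mult_right half_gaussian_moment)
  then have "has_bochner_integral lborel
      (\<lambda>z. indicator {0<..} z * (exp (-z\<^sup>2) * (1 / r + z\<^sup>2 / a\<^sup>2) ^ 2))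
      (sqrt pi / 2 * (1 / r\<^sup>2 + 1 / (r * a\<^sup>2) + 3 / (4 * a ^ 4)))"
    by (rule arg_cong2[where f = "has_bochner_integral lborel", THEN iffD1, rotated 2])
      (use a r in \<open>auto simp: field_simps fun_eq_iff power2_sum power_divide fact_numeral power2_eq_square power4_eq_xxxx\<close>)
  from has_bochner_integral_abel_moment[OF a r this] show ?thesis by simp
qed

text \<open>The kernel is \<open>a / sqrt pi\<close> times the weight in \<open>moment0\<close>. The
  half integral is left unnormalised, hence the factor \<open>sqrt pi\<close>, which is
  \<open>Gamma (1/2)\<close>, here and in the next two lemmas.\<close>

lemma abel_levy_density:
  "has_bochner_integral lborel
     (\<lambda>s. indicator {0<..<r} s * ((r - s) powr (-1/2) * levy_density a s)) (sqrt pi * abel_gauss a r)"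
proof -
  have "has_bochner_integral lborel (\<lambda>s. a / sqrt pi *
      (indicator {0<..<r} s * ((r - s) powr (-1/2) * (1 / (s * sqrt s) * exp (- a\<^sup>2 / s)))))
     (a / sqrt pi * (2 / (a * sqrt r) * exp (- a\<^sup>2 / r) * (sqrt pi / 2)))"
    by (intro has_bochner_integral_mult_right moment0)
  then show ?thesis
    by (rule arg_cong2[where f = "has_bochner_integral lborel", THEN iffD1, rotated 2])
      (use a r in \<open>auto simp: levy_density_def abel_gauss_def indicator_def\<close>)
qed

text \<open>Combining \<open>moment2\<close> and \<open>moment1\<close>, the two terms
  \<open>3 / (4 * a)\<close> cancel, and what remains is
  \<open>a^3/r^2 + a/r - 3*a/(2*r) = a * (a^2/r^2 - 1/(2*r))\<close>.\<close>

lemma abel_levy_density':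
  "has_bochner_integral lborel
     (\<lambda>s. indicator {0<..<r} s * ((r - s) powr (-1/2) * levy_density' a s)) (sqrt pi * abel_gauss' a r)"
proof -
  have "has_bochner_integral lborel (\<lambda>s. a ^ 3 / sqrt pi *
      (indicator {0<..<r} s * ((r - s) powr (-1/2) * ((1 / s)\<^sup>2 / (s * sqrt s) * exp (- a\<^sup>2 / s))))
     - 3 * a / (2 * sqrt pi) *
      (indicator {0<..<r} s * ((r - s) powr (-1/2) * ((1 / s) / (s * sqrt s) * exp (- a\<^sup>2 / s)))))
     (a ^ 3 / sqrt pi * (2 / (a * sqrt r) * exp (- a\<^sup>2 / r) *
        (sqrt pi / 2 * (1 / r\<^sup>2 + 1 / (r * a\<^sup>2) + 3 / (4 * a ^ 4))))
      - 3 * a / (2 * sqrt pi) * (2 / (a * sqrt r) * exp (- a\<^sup>2 / r) *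
         (sqrt pi / 2 * (1 / r + 1 / (2 * a\<^sup>2)))))"
    by (intro has_bochner_integral_diff has_bochner_integral_mult_right moment1 moment2)
  then show ?thesis
  proof (rule arg_cong2[where f = "has_bochner_integral lborel", THEN iffD1, rotated 2])
    show "(\<lambda>s. a ^ 3 / sqrt pi *
      (indicator {0<..<r} s * ((r - s) powr (-1/2) * ((1 / s)\<^sup>2 / (s * sqrt s) * exp (- a\<^sup>2 / s))))
     - 3 * a / (2 * sqrt pi) *
      (indicator {0<..<r} s * ((r - s) powr (-1/2) * ((1 / s) / (s * sqrt s) * exp (- a\<^sup>2 / s)))))
     = (\<lambda>s. indicator {0<..<r} s * ((r - s) powr (-1/2) * levy_density' a s))"
      by (auto simp: levy_density_def levy_density'_def indicator_def fun_eq_iff divide_simps)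
         (simp add: algebra_simps power2_eq_square power3_eq_cube)
  qed (use a r in \<open>simp add: abel_gauss'_def abel_gauss_def divide_simps,
       simp add: algebra_simps eval_nat_numeral\<close>)
qed

text \<open>Here the two constants 1/2 cancel and only \<open>a^2/r\<close> survives: the half
  derivative of the Gaussian kernel is the stable density.\<close>

lemma abel_abel_gauss':
  "has_bochner_integral lborel
     (\<lambda>s. indicator {0<..<r} s * ((r - s) powr (-1/2) * abel_gauss' a s)) (sqrt pi * levy_density a r)"
proof -
  have "has_bochner_integral lborel (\<lambda>s. a\<^sup>2 / sqrt pi *
      (indicator {0<..<r} s * ((r - s) powr (-1/2) * ((1 / s) / (s * sqrt s) * exp (- a\<^sup>2 / s))))
     - 1 / (2 * sqrt pi) *
      (indicator {0<..<r} s * ((r - s) powr (-1/2) * (1 / (s * sqrt s) * exp (- a\<^sup>2 / s)))))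
     (a\<^sup>2 / sqrt pi * (2 / (a * sqrt r) * exp (- a\<^sup>2 / r) *
        (sqrt pi / 2 * (1 / r + 1 / (2 * a\<^sup>2))))
      - 1 / (2 * sqrt pi) * (2 / (a * sqrt r) * exp (- a\<^sup>2 / r) * (sqrt pi / 2)))"
    by (intro has_bochner_integral_diff has_bochner_integral_mult_right moment0 moment1)
  then show ?thesis
  proof (rule arg_cong2[where f = "has_bochner_integral lborel", THEN iffD1, rotated 2])
    show "(\<lambda>s. a\<^sup>2 / sqrt pi *
      (indicator {0<..<r} s * ((r - s) powr (-1/2) * ((1 / s) / (s * sqrt s) * exp (- a\<^sup>2 / s))))
     - 1 / (2 * sqrt pi) *
      (indicator {0<..<r} s * ((r - s) powr (-1/2) * (1 / (s * sqrt s) * exp (- a\<^sup>2 / s)))))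
     = (\<lambda>s. indicator {0<..<r} s * ((r - s) powr (-1/2) * abel_gauss' a s))"
      by (auto simp: abel_gauss_def abel_gauss'_def indicator_def fun_eq_iff divide_simps)
         (simp add: algebra_simps power2_eq_square power3_eq_cube)
  qed (use a r in \<open>simp add: levy_density_def divide_simps,
       simp add: algebra_simps eval_nat_numeral\<close>)
qed

end

section \<open>The fractional equation for the density\<close>

lemma has_field_derivative_zero_of_quadratic:
  fixes f :: "real \<Rightarrow> real"
  assumes "f x = 0" and "\<forall>\<^sub>F y in at x. \<bar>f y\<bar> \<le> C * (y - x)\<^sup>2"
  shows "(f has_field_derivative 0) (at x)"
proof -
  have "((\<lambda>y. (f y - f x) / (y - x)) \<longlongrightarrow> 0) (at x)"
  proof (rule Lim_null_comparison)
    have "\<forall>\<^sub>F y in at x. y \<noteq> x" by (simp add: eventually_at_filter)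
    with assms(2) show "\<forall>\<^sub>F y in at x. norm ((f y - f x) / (y - x)) \<le> C * \<bar>y - x\<bar>"
    proof eventually_elim
      case (elim y)
      then have "\<bar>f y\<bar> \<le> (C * \<bar>y - x\<bar>) * \<bar>y - x\<bar>"
        by (simp add: power2_eq_square mult.assoc)
      with elim show ?case by (simp add: assms(1) divide_le_eq)
    qed
    show "((\<lambda>y. C * \<bar>y - x\<bar>) \<longlongrightarrow> 0) (at x)"
      by (rule tendsto_eq_intros refl | simp)+
  qed
  then show ?thesis by (simp add: has_field_derivative_iff)
qed

text \<open>Fourth power of \<open>x/4 \<le> exp (x/4)\<close>, so the constant is
  \<open>4^4\<close>. At \<open>x = a^2/s\<close> degree four absorbs \<open>s\<close> to the power
  -3/2 and still leaves \<open>s^2\<close>.\<close>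

lemma exp_minus_le_power4: "exp (- x) \<le> 256 / x ^ 4" if "x > 0" for x :: real
proof -
  have "x / 4 \<le> exp (x / 4)" using exp_ge_add_one_self[of "x / 4"] by linarith
  then have "(x / 4) ^ 4 \<le> exp (x / 4) ^ 4" using that by (intro power_mono) auto
  also have "\<dots> = exp x" by (simp add: exp_of_nat_mult[symmetric])
  finally show ?thesis using that by (simp add: exp_minus field_simps)
qed

text \<open>Quadratic decay forces derivative 0 at the cutoff. For \<open>0 < s \<le> 1\<close> the
  exponential bound leaves the powers 7/2 and 5/2 of \<open>s\<close>, both at most
  \<open>s^2\<close>.\<close>

lemma kernels_le_quadratic:
  assumes a: "a > 0" and s: "s \<le> 1"
  shows "\<bar>abel_gauss a s\<bar> \<le> 256 / a ^ 8 * s\<^sup>2" "\<bar>levy_density a s\<bar> \<le> 256 / a ^ 7 * s\<^sup>2"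
proof -
  have "\<bar>abel_gauss a s\<bar> \<le> 256 / a ^ 8 * s\<^sup>2 \<and> \<bar>levy_density a s\<bar> \<le> 256 / a ^ 7 * s\<^sup>2"
  proof (cases "s > 0")
    case False
    then show ?thesis using a by (simp add: abel_gauss_def levy_density_def)
  next
    case True
    have "exp (- (a\<^sup>2 / s)) \<le> 256 / (a\<^sup>2 / s) ^ 4"
      using True a by (intro exp_minus_le_power4) auto
    also have "\<dots> = 256 / a ^ 8 * s ^ 4" by (simp add: power_divide flip: power_mult)
    finally have e: "exp (- a\<^sup>2 / s) \<le> 256 / a ^ 8 * s ^ 4" by simp
    have sq: "0 < sqrt s" "sqrt s \<le> 1" "sqrt s * sqrt s = s" using True s by auto
    \<comment> \<open>In terms of the root \<open>S\<close>, identities mixing \<open>s\<close> and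
      \<open>sqrt s\<close> become rational.\<close>
    define S where "S = sqrt s"
    have S: "S > 0" "s = S\<^sup>2" "sqrt s = S" using True by (auto simp: S_def)
    have s2: "s * sqrt s \<le> 1" using True s by (intro mult_le_one) auto
    have "sqrt pi \<ge> 1" using pi_ge_two by simp
    then have k: "x / (sqrt pi * d) \<le> x / d" if "x \<ge> 0" "d > 0" for x d :: real
      using that mult_right_mono[of 1 "sqrt pi" d] by (intro divide_left_mono) auto
    have "abel_gauss a s \<le> exp (- a\<^sup>2 / s) / sqrt s"
      using True sq k[of "exp (- a\<^sup>2 / s)" "sqrt s"] by (simp add: abel_gauss_def)
    also have "\<dots> \<le> 256 / a ^ 8 * s ^ 4 / sqrt s"
      using e sq by (intro divide_right_mono) auto
    also have "\<dots> = 256 / a ^ 8 * s\<^sup>2 * (s * sqrt s) * (s / (sqrt s * sqrt s))"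
      using S(1) unfolding S(2) by (simp add: eval_nat_numeral)
    also have "\<dots> \<le> 256 / a ^ 8 * s\<^sup>2 * 1 * (s / (sqrt s * sqrt s))"
      using s2 True a by (intro mult_right_mono mult_left_mono) auto
    finally have 1: "abel_gauss a s \<le> 256 / a ^ 8 * s\<^sup>2" using sq True by simp
    have "levy_density a s \<le> a * exp (- a\<^sup>2 / s) / (s * sqrt s)"
      using True sq a k[of "a * exp (- a\<^sup>2 / s)" "s * sqrt s"] by (simp add: levy_density_def)
    also have "\<dots> \<le> a * (256 / a ^ 8 * s ^ 4) / (s * sqrt s)"
      using e sq True a by (intro divide_right_mono mult_left_mono) auto
    also have "\<dots> = 256 / a ^ 7 * s\<^sup>2 * sqrt s * (s / (sqrt s * sqrt s))"
      using S(1) a unfolding S(2) by (simp add: eval_nat_numeral)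
    also have "\<dots> \<le> 256 / a ^ 7 * s\<^sup>2 * 1 * (s / (sqrt s * sqrt s))"
      using sq True a by (intro mult_right_mono mult_left_mono) auto
    finally have 2: "levy_density a s \<le> 256 / a ^ 7 * s\<^sup>2" using sq True by simp
    have "abel_gauss a s \<ge> 0" "levy_density a s \<ge> 0"
      using a by (auto simp: abel_gauss_def levy_density_def)
    with 1 2 show ?thesis by simp
  qed
  then show "\<bar>abel_gauss a s\<bar> \<le> 256 / a ^ 8 * s\<^sup>2" "\<bar>levy_density a s\<bar> \<le> 256 / a ^ 7 * s\<^sup>2"
    by auto
qed

text \<open>If \<open>g x < 0\<close>, the composite is locally zero. If \<open>g x = 0\<close>,
  then \<open>g y\<close> is of order \<open>y - x\<close>, and the bound on \<open>K\<close>,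
  uniform while \<open>f y\<close> stays away from 0, makes the composite of order
  \<open>(y - x)^2\<close>.\<close>

lemma has_field_derivative_zero_of_vanishing:
  fixes K :: "real \<Rightarrow> real \<Rightarrow> real"
  assumes f: "isCont f x" and fx: "f x > 0"
    and g: "(g has_field_derivative g') (at x)" and gx: "g x \<le> 0"
    and neg: "\<And>a s. s \<le> 0 \<Longrightarrow> K a s = 0"
    and bound: "\<And>a s. 0 < a \<Longrightarrow> s \<le> 1 \<Longrightarrow> \<bar>K a s\<bar> \<le> C / a ^ n * s\<^sup>2" and C: "C \<ge> 0"
  shows "((\<lambda>x. K (f x) (g x)) has_field_derivative 0) (at x)"
proof -
  have gc: "isCont g x" using g by (rule DERIV_isCont)
  show ?thesis
  proof (cases "g x < 0")
    case True
    have "\<forall>\<^sub>F y in nhds x. g y < 0"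
      using gc True order_tendstoD(2)[of g "g x" "nhds x" 0]
      by (simp add: isCont_def tendsto_at_iff_tendsto_nhds)
    then have "\<forall>\<^sub>F y in nhds x. 0 = K (f y) (g y)"
      by eventually_elim (simp add: neg)
    then show ?thesis
      using DERIV_cong_ev[where x = x and y = x and f = "\<lambda>_. 0" and g = "\<lambda>y. K (f y) (g y)"
          and u = 0 and v = 0] by simp
  next
    case False
    with gx have g0: "g x = 0" by simp
    have "((\<lambda>y. (g y - g x) / (y - x)) \<longlongrightarrow> g') (at x)"
      using g by (simp add: has_field_derivative_iff)
    then have "((\<lambda>y. \<bar>(g y - g x) / (y - x)\<bar>) \<longlongrightarrow> \<bar>g'\<bar>) (at x)" by (rule tendsto_rabs)
    then have e1: "\<forall>\<^sub>F y in at x. \<bar>(g y - g x) / (y - x)\<bar> < \<bar>g'\<bar> + 1"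
      by (rule order_tendstoD) simp
    have e2: "\<forall>\<^sub>F y in at x. f y > f x / 2"
      using f fx by (intro order_tendstoD(1)[of f "f x"]) (auto simp: isCont_def)
    have e3: "\<forall>\<^sub>F y in at x. g y < 1"
      using gc g0 by (intro order_tendstoD(2)[of g "g x"]) (auto simp: isCont_def)
    have e4: "\<forall>\<^sub>F y in at x. y \<noteq> x" by (simp add: eventually_at_filter)
    show ?thesis
    proof (rule has_field_derivative_zero_of_quadratic)
      show "K (f x) (g x) = 0" by (simp add: neg g0)
      \<comment> \<open>Near \<open>x\<close> the difference quotient of \<open>g\<close> is below
        \<open>\<bar>g'\<bar> + 1\<close> in absolute value and \<open>f\<close> stays above
        \<open>f x / 2\<close>; this explains the constant.\<close>
      show "\<forall>\<^sub>F y in at x. \<bar>K (f y) (g y)\<bar> \<le> (C / (f x / 2) ^ n * (\<bar>g'\<bar> + 1)\<^sup>2) * (y - x)\<^sup>2"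
        using e1 e2 e3 e4
      proof eventually_elim
        case (elim y)
        have "\<bar>g y\<bar> \<le> (\<bar>g'\<bar> + 1) * \<bar>y - x\<bar>"
          using elim by (simp add: g0 divide_less_eq less_imp_le)
        then have "\<bar>g y\<bar>\<^sup>2 \<le> ((\<bar>g'\<bar> + 1) * \<bar>y - x\<bar>)\<^sup>2" by (rule power_mono) simp
        then have *: "(g y)\<^sup>2 \<le> (\<bar>g'\<bar> + 1)\<^sup>2 * (y - x)\<^sup>2" by (simp add: power_mult_distrib)
        have "\<bar>K (f y) (g y)\<bar> \<le> C / f y ^ n * (g y)\<^sup>2"
          using elim fx by (intro bound) auto
        also have "\<dots> \<le> C / (f x / 2) ^ n * ((\<bar>g'\<bar> + 1)\<^sup>2 * (y - x)\<^sup>2)"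
        proof (intro mult_mono * divide_left_mono power_mono C)
          show "0 < f y ^ n * (f x / 2) ^ n"
            using fx elim by (intro mult_pos_pos zero_less_power) auto
        qed (use elim fx C in auto)
        finally show ?case by (simp add: mult.assoc)
      qed
    qed
  qed
qed

text \<open>Besides the derivatives in \<open>s\<close>, two relations enter: the derivative of
  \<open>abel_gauss\<close> in \<open>a\<close> is \<open>-2\<close> times
  \<open>levy_density\<close>, and that of \<open>levy_density\<close> is \<open>-2\<close> times
  \<open>abel_gauss'\<close>. Together they are the heat equation. Where \<open>g x \<le> 0\<close>,
  the cutoffs make the stated derivatives 0 as well.\<close>

lemma has_field_derivative_kernels:
  assumes f: "(f has_field_derivative f') (at x)" and fx: "f x > 0"
    and g: "(g has_field_derivative g') (at x)"
  shows "((\<lambda>x. abel_gauss (f x) (g x)) has_field_derivative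
            abel_gauss' (f x) (g x) * g' - 2 * levy_density (f x) (g x) * f') (at x)"
    and "((\<lambda>x. levy_density (f x) (g x)) has_field_derivative
            levy_density' (f x) (g x) * g' - 2 * abel_gauss' (f x) (g x) * f') (at x)"
proof -
  have fc: "isCont f x" using f by (rule DERIV_isCont)
  have gc: "isCont g x" using g by (rule DERIV_isCont)
  have "((\<lambda>x. abel_gauss (f x) (g x)) has_field_derivative
            abel_gauss' (f x) (g x) * g' - 2 * levy_density (f x) (g x) * f') (at x) \<and>
        ((\<lambda>x. levy_density (f x) (g x)) has_field_derivative
            levy_density' (f x) (g x) * g' - 2 * abel_gauss' (f x) (g x) * f') (at x)"
  proof (cases "g x > 0")
    case True
    have ev: "\<forall>\<^sub>F y in nhds x. g y > 0"
      using gc True order_tendstoD(1)[of g "g x" "nhds x" 0]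
      by (simp add: isCont_def tendsto_at_iff_tendsto_nhds)
    define G where "G = sqrt (g x)"
    have G: "G > 0" "g x = G\<^sup>2" using True by (auto simp: G_def)
    have P: "sqrt pi > 0" by simp
    have 1: "((\<lambda>x. exp (- (f x)\<^sup>2 / g x) / (sqrt pi * sqrt (g x))) has_field_derivative
            abel_gauss' (f x) (g x) * g' - 2 * levy_density (f x) (g x) * f') (at x)"
      using True G fx unfolding abel_gauss'_def levy_density_def abel_gauss_def
      apply (auto intro!: derivative_eq_intros f g)
      apply (simp add: divide_simps flip: G_def)
      apply (simp add: algebra_simps eval_nat_numeral)
      done
    have 2: "((\<lambda>x. f x * exp (- (f x)\<^sup>2 / g x) / (sqrt pi * (g x * sqrt (g x)))) has_field_derivative
            levy_density' (f x) (g x) * g' - 2 * abel_gauss' (f x) (g x) * f') (at x)"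
      using True G fx unfolding abel_gauss'_def levy_density_def abel_gauss_def levy_density'_def
      apply (auto intro!: derivative_eq_intros f g)
      apply (simp add: divide_simps flip: G_def)
      apply (simp add: algebra_simps eval_nat_numeral)
      done
    have "\<forall>\<^sub>F y in nhds x. exp (- (f y)\<^sup>2 / g y) / (sqrt pi * sqrt (g y)) = abel_gauss (f y) (g y)"
      "\<forall>\<^sub>F y in nhds x. f y * exp (- (f y)\<^sup>2 / g y) / (sqrt pi * (g y * sqrt (g y))) = levy_density (f y) (g y)"
      using ev by (eventually_elim, simp add: abel_gauss_def levy_density_def)+
    note 3 = DERIV_cong_ev[OF refl this(1) refl] DERIV_cong_ev[OF refl this(2) refl]
    show ?thesis using 1 2 unfolding 3 by blast
  next
    case False
    have "((\<lambda>x. abel_gauss (f x) (g x)) has_field_derivative 0) (at x)"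
      by (rule has_field_derivative_zero_of_vanishing[OF fc fx g, of abel_gauss, OF _ _ kernels_le_quadratic(1)])
        (use False in \<open>auto simp: abel_gauss_def\<close>)
    moreover have "((\<lambda>x. levy_density (f x) (g x)) has_field_derivative 0) (at x)"
      by (rule has_field_derivative_zero_of_vanishing[OF fc fx g, of levy_density, OF _ _ kernels_le_quadratic(2)])
        (use False in \<open>auto simp: levy_density_def\<close>)
    ultimately show ?thesis using False
      by (simp add: abel_gauss_def levy_density_def levy_density'_def abel_gauss'_def)
  qed
  then show "((\<lambda>x. abel_gauss (f x) (g x)) has_field_derivative
            abel_gauss' (f x) (g x) * g' - 2 * levy_density (f x) (g x) * f') (at x)"
    and "((\<lambda>x. levy_density (f x) (g x)) has_field_derivative
            levy_density' (f x) (g x) * g' - 2 * abel_gauss' (f x) (g x) * f') (at x)" by auto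
qed

text \<open>Causality: \<open>h\<close> vanishes up to 0, so delaying it by \<open>c \<ge> 0\<close>
  confines the integrand to \<open>c < s < t\<close>, a translate of \<open>0 < s < t - c\<close>.
  If \<open>t \<le> c\<close> nothing is left and the value is 0.\<close>

lemma has_bochner_integral_abel_shift:
  fixes h :: "real \<Rightarrow> real"
  assumes h: "\<And>s. s \<le> 0 \<Longrightarrow> h s = 0" and c: "c \<ge> 0" and b: "r \<le> 0 \<Longrightarrow> b = 0"
    and I: "r > 0 \<Longrightarrow> has_bochner_integral lborel
           (\<lambda>s. indicator {0<..<r} s * ((r - s) powr (-1/2) * h s)) b"
    and r: "r = t - c"
  shows "has_bochner_integral lborel
           (\<lambda>s. indicator {0<..<t} s * ((t - s) powr (-1/2) * h (s - c))) b"
proof -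
  have "has_bochner_integral lborel
           (\<lambda>s. indicator {0<..<r} s * ((r - s) powr (-1/2) * h s)) b"
  proof (cases "r > 0")
    case False
    then have "{0<..<r} = {}" by auto
    then show ?thesis using b False by (simp add: has_bochner_integral_zero)
  qed (rule I)
  then have "has_bochner_integral lborel
           (\<lambda>s. indicator {0<..<r} (- c + 1 * s) * ((r - (- c + 1 * s)) powr (-1/2) * h (- c + 1 * s))) (b /\<^sub>R \<bar>1\<bar>)"
    by (subst (asm) lborel_has_bochner_integral_real_affine_iff[where c = 1 and t = "- c"]) auto
  also have "(\<lambda>s. indicator {0<..<r} (- c + 1 * s) * ((r - (- c + 1 * s)) powr (-1/2) * h (- c + 1 * s)))
     = (\<lambda>s. indicator {0<..<t} s * ((t - s) powr (-1/2) * h (s - c)))"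
    using h c by (auto simp: fun_eq_iff indicator_def r)
  finally show ?thesis by simp
qed

lemma abel_shifted_kernels:
  assumes a: "a > 0" and c: "c \<ge> 0"
  shows "has_bochner_integral lborel (\<lambda>s. indicator {0<..<t} s *
      ((t - s) powr (-1/2) * levy_density a (s - c))) (sqrt pi * abel_gauss a (t - c))"
    and "has_bochner_integral lborel (\<lambda>s. indicator {0<..<t} s *
      ((t - s) powr (-1/2) * levy_density' a (s - c))) (sqrt pi * abel_gauss' a (t - c))"
    and "has_bochner_integral lborel (\<lambda>s. indicator {0<..<t} s *
      ((t - s) powr (-1/2) * abel_gauss' a (s - c))) (sqrt pi * levy_density a (t - c))"
proof -
  have zero: "levy_density a s = 0" "levy_density' a s = 0" "abel_gauss a s = 0" "abel_gauss' a s = 0"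
    if "s \<le> 0" for s
    using that by (auto simp: levy_density_def levy_density'_def abel_gauss_def abel_gauss'_def)
  show "has_bochner_integral lborel (\<lambda>s. indicator {0<..<t} s *
      ((t - s) powr (-1/2) * levy_density a (s - c))) (sqrt pi * abel_gauss a (t - c))"
    by (rule has_bochner_integral_abel_shift[where h = "levy_density a", OF _ c _ abel_levy_density[OF a] refl])
      (auto simp: zero)
  show "has_bochner_integral lborel (\<lambda>s. indicator {0<..<t} s *
      ((t - s) powr (-1/2) * levy_density' a (s - c))) (sqrt pi * abel_gauss' a (t - c))"
    by (rule has_bochner_integral_abel_shift[where h = "levy_density' a", OF _ c _ abel_levy_density'[OF a] refl])
      (auto simp: zero)
  show "has_bochner_integral lborel (\<lambda>s. indicator {0<..<t} s *
      ((t - s) powr (-1/2) * abel_gauss' a (s - c))) (sqrt pi * levy_density a (t - c))"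
    by (rule has_bochner_integral_abel_shift[where h = "abel_gauss' a", OF _ c _ abel_abel_gauss'[OF a] refl])
      (auto simp: zero)
qed

section \<open>The density as a combination of kernels\<close>

text \<open>With \<open>a = n1 * y / 2\<close> and \<open>r = t - n2 * y\<close>, the prefactor
  \<open>n1 * (t - n2 * y / 2)\<close> equals \<open>n1 * r + n2 * a\<close>; its two summands give
  the two kernels.\<close>

lemma q_half_one_kernels:
  assumes "n2 > 0" "y > 0"
  shows "q_half_one n1 n2 y t =
    n1 * abel_gauss (n1 * y / 2) (t - n2 * y) + n2 * levy_density (n1 * y / 2) (t - n2 * y)"
proof (cases "t > n2 * y")
  case True
  define r where "r = t - n2 * y"
  have r: "r > 0" "t = r + n2 * y" using True by (auto simp: r_def)
  have t: "t > 0" using True assms by (meson less_trans mult_pos_pos)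
  have e: "- (n1\<^sup>2 * y\<^sup>2 / (4 * r)) = - (n1 * y / 2)\<^sup>2 / r"
    by (simp add: power_mult_distrib power_divide)
  have s: "sqrt (r ^ 3) = r * sqrt r" using r by (simp add: eval_nat_numeral real_sqrt_mult)
  have c: "t - n2 / 2 * y = r + n2 * y / 2" by (simp add: r)
  have "q_half_one n1 n2 y t = n1 * (r + n2 * y / 2) / sqrt pi
       * (exp (- (n1 * y / 2)\<^sup>2 / r) / (r * sqrt r))"
    using True assms t unfolding q_half_one_def r_def[symmetric] e s c
    by (simp add: field_simps)
  also have "\<dots> = n1 * abel_gauss (n1 * y / 2) r + n2 * levy_density (n1 * y / 2) r"
    using r by (simp add: abel_gauss_def levy_density_def divide_simps) (simp add: algebra_simps)
  finally show ?thesis by (simp add: r_def)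
next
  case False
  then show ?thesis using assms
    by (auto simp: q_half_one_def abel_gauss_def levy_density_def field_simps)
qed

context
  fixes n1 n2 :: real
  assumes n1: "n1 > 0" and n2: "n2 > 0"
begin

lemma q_half_one_deriv_time:
  assumes y: "y > 0"
  shows "((\<lambda>s. q_half_one n1 n2 y s) has_field_derivative
     n1 * abel_gauss' (n1 * y / 2) (t - n2 * y) + n2 * levy_density' (n1 * y / 2) (t - n2 * y)) (at t)"
  unfolding q_half_one_kernels[OF n2 y]
  by (rule derivative_eq_intros has_field_derivative_kernels refl | use n1 y in simp)+

text \<open>Chain rule with inner derivatives \<open>n1 / 2\<close> and \<open>- n2\<close>; each of
  the two kernels contributes one copy of the mixed term.\<close>

lemma q_half_one_deriv_space:
  assumes y: "y > 0"
  shows "((\<lambda>x. q_half_one n1 n2 x t) has_field_derivative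
     - (n1\<^sup>2 * levy_density (n1 * y / 2) (t - n2 * y)
        + 2 * n1 * n2 * abel_gauss' (n1 * y / 2) (t - n2 * y)
        + n2\<^sup>2 * levy_density' (n1 * y / 2) (t - n2 * y))) (at y)"
proof -
  have *: "((\<lambda>x. n1 * x / 2) has_field_derivative n1 / 2) (at y)"
    "((\<lambda>x. t - n2 * x) has_field_derivative - n2) (at y)"
    by (auto intro!: derivative_eq_intros)
  have "((\<lambda>x. n1 * abel_gauss (n1 * x / 2) (t - n2 * x) + n2 * levy_density (n1 * x / 2) (t - n2 * x))
     has_field_derivative
     - (n1\<^sup>2 * levy_density (n1 * y / 2) (t - n2 * y)
        + 2 * n1 * n2 * abel_gauss' (n1 * y / 2) (t - n2 * y)
        + n2\<^sup>2 * levy_density' (n1 * y / 2) (t - n2 * y))) (at y)"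
    using n1 y
    by (intro DERIV_cong[OF DERIV_add[OF DERIV_cmult[OF has_field_derivative_kernels(1)[OF *(1) _ *(2)]]
           DERIV_cmult[OF has_field_derivative_kernels(2)[OF *(1) _ *(2)]]]])
       (auto simp: algebra_simps power2_eq_square)
  moreover have "\<forall>\<^sub>F x in nhds y. n1 * abel_gauss (n1 * x / 2) (t - n2 * x)
      + n2 * levy_density (n1 * x / 2) (t - n2 * x) = q_half_one n1 n2 x t"
    using eventually_nhds_in_open[of "{0<..}" y] y
    by (auto elim!: eventually_mono simp: q_half_one_kernels n2)
  ultimately show ?thesis
    by (subst DERIV_cong_ev[OF refl _ refl, symmetric]) auto
qed

text \<open>Half integration of the time derivative sends \<open>abel_gauss'\<close> to
  \<open>levy_density\<close> and \<open>levy_density'\<close> to \<open>abel_gauss'\<close>. The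
  normalisation \<open>1 / Gamma (1/2)\<close> cancels the factor \<open>sqrt pi\<close> of the Abel
  identities.\<close>

lemma q_half_one_caputo:
  assumes y: "y > 0"
  shows "caputo_half_exists (\<lambda>s. q_half_one n1 n2 y s) t"
    and "caputo_half (\<lambda>s. q_half_one n1 n2 y s) t =
       n1 * levy_density (n1 * y / 2) (t - n2 * y) + n2 * abel_gauss' (n1 * y / 2) (t - n2 * y)"
proof -
  define a c where "a = n1 * y / 2" and "c = n2 * y"
  have ac: "a > 0" "c \<ge> 0" using n1 n2 y by (auto simp: a_def c_def)
  have d: "deriv (\<lambda>s. q_half_one n1 n2 y s) s = n1 * abel_gauss' a (s - c) + n2 * levy_density' a (s - c)" for s
    unfolding a_def c_def by (intro DERIV_imp_deriv q_half_one_deriv_time y)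
  have "has_bochner_integral lborel (\<lambda>s.
      n1 * (indicator {0<..<t} s * ((t - s) powr (-1/2) * abel_gauss' a (s - c)))
      + n2 * (indicator {0<..<t} s * ((t - s) powr (-1/2) * levy_density' a (s - c))))
     (n1 * (sqrt pi * levy_density a (t - c)) + n2 * (sqrt pi * abel_gauss' a (t - c)))"
    by (intro has_bochner_integral_add has_bochner_integral_mult_right abel_shifted_kernels ac)
  then have I: "has_bochner_integral lborel (\<lambda>s. indicator {0<..<t} s *\<^sub>R ((t - s) powr (-1/2) *
        deriv (\<lambda>s. q_half_one n1 n2 y s) s))
     (sqrt pi * (n1 * levy_density a (t - c) + n2 * abel_gauss' a (t - c)))"
    by (simp add: d algebra_simps)
  show "caputo_half_exists (\<lambda>s. q_half_one n1 n2 y s) t"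
    unfolding caputo_half_exists_def set_integrable_def
    using I q_half_one_deriv_time[OF y]
    by (auto simp: has_bochner_integral_iff field_differentiable_def)
  show "caputo_half (\<lambda>s. q_half_one n1 n2 y s) t =
       n1 * levy_density (n1 * y / 2) (t - n2 * y) + n2 * abel_gauss' (n1 * y / 2) (t - n2 * y)"
    unfolding caputo_half_def set_lebesgue_integral_def
    using I by (simp add: has_bochner_integral_iff Gamma_one_half_real a_def c_def)
qed

end

section \<open>The process\<close>

text \<open>The modulus of a centred Gaussian of variance 1/2. At this scale the exponent
  \<open>z^2\<close> is exactly that of \<open>q_half_one\<close> under the change of variables
  below.\<close>

definition half_normal_density :: "real \<Rightarrow> real" where
  "half_normal_density z = (if 0 < z then 2 / sqrt pi * exp (- z\<^sup>2) else 0)"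

definition half_normal :: "real measure" where
  "half_normal = density lborel (\<lambda>z. ennreal (half_normal_density z))"

lemma measurable_half_normal_density [measurable]: "half_normal_density \<in> borel_measurable borel"
  unfolding half_normal_density_def[abs_def] by measurable

lemma half_normal_density_nonneg [simp]: "half_normal_density z \<ge> 0"
  by (simp add: half_normal_density_def)

lemma sets_half_normal [simp, measurable_cong]: "sets half_normal = sets borel"
  by (simp add: half_normal_def)

lemma space_half_normal [simp]: "space half_normal = UNIV"
  by (simp add: half_normal_def)

lemma has_bochner_integral_half_normal_density: "has_bochner_integral lborel half_normal_density 1"
proof -
  have "has_bochner_integral lborel (\<lambda>z. 2 / sqrt pi * (indicator {0<..} z * (exp (-z\<^sup>2) * z ^ (2 * 0))))
     (2 / sqrt pi * (sqrt pi / 2 * (fact (2 * 0) / (2 ^ (2 * 0) * fact 0))))"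
    by (intro has_bochner_integral_mult_right half_gaussian_moment)
  also have "(\<lambda>z. 2 / sqrt pi * (indicator {0<..} z * (exp (-z\<^sup>2) * z ^ (2 * 0)))) = half_normal_density"
    by (auto simp: fun_eq_iff half_normal_density_def indicator_def)
  finally show ?thesis by simp
qed

lemma prob_space_half_normal: "prob_space half_normal"
proof
  show "emeasure half_normal (space half_normal) = 1"
    using has_bochner_integral_half_normal_density
    by (simp add: half_normal_def emeasure_density nn_integral_eq_integral has_bochner_integral_iff)
qed

lemma AE_half_normal_pos: "AE z in half_normal. 0 < z"
  unfolding half_normal_def by (subst AE_density) (auto simp: half_normal_density_def)

text \<open>For \<open>z > 0\<close>, the positive root \<open>y\<close> of \<open>n\<^sub>2 y + (n\<^sub>1 y / (2 z))\<^sup>2 = t\<close>.\<close>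

definition passage :: "real \<Rightarrow> real \<Rightarrow> real \<Rightarrow> real \<Rightarrow> real" where
  "passage n1 n2 t z = 2 * z / n1\<^sup>2 * (sqrt (n2\<^sup>2 * z\<^sup>2 + n1\<^sup>2 * t) - n2 * z)"

lemma measurable_passage [measurable]:
  "(\<lambda>z. passage n1 n2 (f z) (g z)) \<in> borel_measurable M"
  if [measurable]: "f \<in> borel_measurable M" "g \<in> borel_measurable M"
  unfolding passage_def by measurable

lemma passage_zero [simp]: "passage n1 n2 0 z = 0" if "n2 > 0" "z > 0"
  using that by (simp add: passage_def real_sqrt_mult)

lemma passage_nonneg: "0 \<le> passage n1 n2 t z" if "t \<ge> 0" "n2 > 0" "z \<ge> 0"
proof -
  have "n2 * z = sqrt (n2\<^sup>2 * z\<^sup>2)" using that by (simp add: real_sqrt_mult)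
  also have "\<dots> \<le> sqrt (n2\<^sup>2 * z\<^sup>2 + n1\<^sup>2 * t)" using that by simp
  finally show ?thesis using that by (simp add: passage_def)
qed

section \<open>The law of the passage value\<close>

context
  fixes n1 n2 :: real
  assumes n1: "n1 > 0" and n2: "n2 > 0"
begin

lemma q_half_one_nonneg: "q_half_one n1 n2 y t \<ge> 0"
proof -
  have "t - n2 / 2 * y \<ge> 0" if "0 < y" "y < t / n2"
  proof -
    have "n2 * y < t" using that n2 by (simp add: pos_less_divide_eq mult.commute)
    moreover have "0 < n2 * y" using that n2 by simp
    ultimately show ?thesis by simp
  qed
  then show ?thesis using n1 n2
    by (auto simp: q_half_one_def field_simps intro!: mult_nonneg_nonneg)
qed

lemma measurable_q_half_one [measurable]:
  "(\<lambda>x. q_half_one n1 n2 (f x) (g x)) \<in> borel_measurable M"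
  if [measurable]: "f \<in> borel_measurable M" "g \<in> borel_measurable M"
  unfolding q_half_one_def by measurable

context
  fixes t :: real
  assumes t: "t > 0"
begin

text \<open>The relation defining \<open>passage\<close>, solved for \<open>z\<close> instead of
  \<open>y\<close>.\<close>

private definition level :: "real \<Rightarrow> real" where
  "level y = n1 * y / (2 * sqrt (t - n2 * y))"

text \<open>Since \<open>R^2 - n2^2 * z^2 = n1^2 * t\<close>, the remaining time is a perfect
  square: \<open>t - n2 * y = ((R - n2 * z) / n1)^2\<close> for
  \<open>y = passage n1 n2 t z\<close>. Hence it is positive and its root is explicit.\<close>

lemma passage_range: "0 < passage n1 n2 t z" "passage n1 n2 t z < t / n2"
  and level_passage: "level (passage n1 n2 t z) = z" if z: "z > 0"
proof -
  define R where "R = sqrt (n2\<^sup>2 * z\<^sup>2 + n1\<^sup>2 * t)"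
  have R2: "R\<^sup>2 = n2\<^sup>2 * z\<^sup>2 + n1\<^sup>2 * t" unfolding R_def using t by simp
  have "n2 * z = sqrt (n2\<^sup>2 * z\<^sup>2)" using z n2 by (simp add: real_sqrt_mult)
  also have "\<dots> < R" unfolding R_def using t n1 by simp
  finally have D: "R - n2 * z > 0" by simp
  have y: "passage n1 n2 t z = 2 * z / n1\<^sup>2 * (R - n2 * z)" by (simp add: passage_def R_def)
  have "n1\<^sup>2 * (t - n2 * passage n1 n2 t z) = n1\<^sup>2 * t - 2 * n2 * z * (R - n2 * z)"
    using n1 by (simp add: y field_simps)
  also have "\<dots> = (R - n2 * z)\<^sup>2" using R2 by (simp add: power2_eq_square algebra_simps)
  finally have r: "t - n2 * passage n1 n2 t z = ((R - n2 * z) / n1)\<^sup>2"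
    using n1 by (simp add: field_simps)
  then have "t - n2 * passage n1 n2 t z > 0" using D n1 by simp
  then show "passage n1 n2 t z < t / n2" using n2 by (simp add: field_simps)
  show "0 < passage n1 n2 t z" using D n1 z by (simp add: y)
  have sq: "sqrt (t - n2 * passage n1 n2 t z) = (R - n2 * z) / n1" using D n1 by (simp add: r)
  have *: "n1 * (2 * z / n1\<^sup>2 * d) / (2 * (d / n1)) = z" if "d > 0" for d
    using that n1 by (simp add: power2_eq_square)
  show "level (passage n1 n2 t z) = z"
    unfolding level_def sq unfolding y by (rule *[OF D])
qed

context
  fixes y :: real
  assumes y: "0 < y" "y < t / n2"
begin

private lemma r: "t - n2 * y > 0" using y n2 by (simp add: field_simps)

text \<open>Completing the square: with \<open>\<rho>^2 = t - n2 * y\<close> the radicand is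
  \<open>(n1 * (\<rho>^2 + n2 * y / 2) / \<rho>)^2\<close>.\<close>

private lemma sqrt_level:
  "sqrt (n2\<^sup>2 * (level y)\<^sup>2 + n1\<^sup>2 * t) = n1 * (t - n2 * y / 2) / sqrt (t - n2 * y)"
proof -
  define \<rho> where "\<rho> = sqrt (t - n2 * y)"
  have \<rho>: "\<rho> > 0" "t = \<rho>\<^sup>2 + n2 * y" using r by (auto simp: \<rho>_def)
  have p: "0 < \<rho>\<^sup>2 + n2 * y / 2" using \<rho> n2 y by (simp add: add_pos_pos)
  have "n2\<^sup>2 * (level y)\<^sup>2 + n1\<^sup>2 * t = (n1 * (\<rho>\<^sup>2 + n2 * y / 2) / \<rho>)\<^sup>2"
    unfolding level_def \<rho>_def[symmetric] using \<rho>(1) unfolding \<rho>(2)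
    by (simp add: field_simps power2_eq_square)
  then have "sqrt (n2\<^sup>2 * (level y)\<^sup>2 + n1\<^sup>2 * t) = n1 * (\<rho>\<^sup>2 + n2 * y / 2) / \<rho>"
    using n1 \<rho>(1) p by (simp add: abs_mult)
  then show ?thesis unfolding \<rho>_def[symmetric] using \<rho>(2) by simp
qed

lemma level_pos: "level y > 0"
  using r n1 y by (simp add: level_def)

lemma passage_level: "passage n1 n2 t (level y) = y"
proof -
  define \<rho> where "\<rho> = sqrt (t - n2 * y)"
  have \<rho>: "\<rho> > 0" "t = \<rho>\<^sup>2 + n2 * y" using r by (auto simp: \<rho>_def)
  have "n1 * (t - n2 * y / 2) / \<rho> - n2 * level y = n1 * \<rho>"
    unfolding level_def \<rho>_def[symmetric] using \<rho>(1) unfolding \<rho>(2)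
    by (simp add: field_simps power2_eq_square)
  then show ?thesis
    unfolding passage_def sqrt_level \<rho>_def[symmetric] using n1 \<rho>(1)
    by (simp add: level_def \<rho>_def[symmetric] power2_eq_square)
qed

lemma level_deriv:
  "(level has_field_derivative n1 * (t - n2 * y / 2) / (2 * ((t - n2 * y) * sqrt (t - n2 * y)))) (at y)"
proof -
  define \<rho> where "\<rho> = sqrt (t - n2 * y)"
  have \<rho>: "\<rho> > 0" "t - n2 * y = \<rho>\<^sup>2" using r by (auto simp: \<rho>_def)
  show ?thesis
    unfolding level_def[abs_def] using r \<rho>
    apply (auto intro!: derivative_eq_intros simp flip: \<rho>_def)
    apply (simp add: divide_simps power2_eq_square)
    apply (simp add: algebra_simps)
    done
qed

text \<open>The algebraic prefactor of \<open>q_half_one\<close> is the derivative of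
  \<open>level\<close>, up to the constant \<open>2 / sqrt pi\<close> supplied by the half-normal
  density.\<close>

lemma q_half_one_level:
  "q_half_one n1 n2 y t = n1 * (t - n2 * y / 2) / (2 * ((t - n2 * y) * sqrt (t - n2 * y)))
      * half_normal_density (level y)"
proof -
  have s: "sqrt ((t - n2 * y) ^ 3) = (t - n2 * y) * sqrt (t - n2 * y)"
    using r by (simp add: eval_nat_numeral real_sqrt_mult)
  have e: "(level y)\<^sup>2 = n1\<^sup>2 * y\<^sup>2 / (4 * (t - n2 * y))"
    using r by (simp add: level_def power_divide power_mult_distrib)
  show ?thesis
    using t y level_pos by (simp add: q_half_one_def half_normal_density_def s e mult_ac)
qed

text \<open>The left side is the time derivative of \<open>passage\<close> at
  \<open>z = level y\<close>. Expressed through \<open>y\<close> alone, it can be integrated against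
  the law of the process.\<close>

lemma level_over_sqrt: "level y / sqrt (n2\<^sup>2 * (level y)\<^sup>2 + n1\<^sup>2 * t) = y / (2 * t - n2 * y)"
proof -
  have "y / (2 * t - n2 * y) = n1 * y / (2 * (n1 * (t - n2 * y / 2)))"
  proof -
    have "2 * (n1 * (t - n2 * y / 2)) = n1 * (2 * t - n2 * y)" by (simp add: algebra_simps)
    then show ?thesis using n1 by (simp only: mult_divide_mult_cancel_left)
  qed
  then show ?thesis unfolding sqrt_level using r by (simp add: level_def)
qed

text \<open>The speed \<open>y / (2 * t - n2 * y)\<close> has denominator
  \<open>2 * (t - n2 * y / 2)\<close>, which cancels the numerator of
  \<open>q_half_one\<close>.\<close>

lemma levy_density_eq_q:
  "levy_density (n1 * y / 2) (t - n2 * y) = q_half_one n1 n2 y t * (y / (2 * t - n2 * y))"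
proof -
  define c where "c = t - n2 / 2 * y"
  have c: "c > 0" "2 * t - n2 * y = 2 * c"
    using r mult_pos_pos[OF n2 y(1)] by (auto simp: c_def)
  have s: "sqrt ((t - n2 * y) ^ 3) = (t - n2 * y) * sqrt (t - n2 * y)"
    using r by (simp add: eval_nat_numeral real_sqrt_mult)
  have e: "- (n1\<^sup>2 * y\<^sup>2 / (4 * (t - n2 * y))) = - (n1 * y / 2)\<^sup>2 / (t - n2 * y)"
    by (simp add: power_mult_distrib power_divide)
  show ?thesis
    using t y r c(1) unfolding q_half_one_def levy_density_def e s c(2) c_def[symmetric] by (simp add: mult_ac)
qed

end

lemma passage_over_sqrt:
  "z / sqrt (n2\<^sup>2 * z\<^sup>2 + n1\<^sup>2 * t) = passage n1 n2 t z / (2 * t - n2 * passage n1 n2 t z)" if "z > 0"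
  using level_over_sqrt[OF passage_range[OF that]] by (simp add: level_passage that)

text \<open>The density transforms under the inverse map \<open>level\<close>, whose derivative is
  positive on \<open>0 < y < t / n2\<close>. The test function \<open>f\<close> carries
  \<open>A\<close> pulled back by \<open>passage\<close>, so at \<open>level y\<close> it tests
  whether \<open>y\<close> lies in \<open>A\<close>.\<close>

lemma distr_passage:
  "distr half_normal borel (passage n1 n2 t) = density lborel (\<lambda>y. ennreal (q_half_one n1 n2 y t))"
proof (rule measure_eqI)
  fix A assume "A \<in> sets (distr half_normal borel (passage n1 n2 t))"
  then have [measurable]: "A \<in> sets borel" by simp
  let ?S = "{0<..<t / n2}"
  define f where "f z = half_normal_density z * indicator A (passage n1 n2 t z)" for z
  define g' where "g' y = n1 * (t - n2 * y / 2) / (2 * ((t - n2 * y) * sqrt (t - n2 * y)))" for y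
  have [measurable]: "f \<in> borel_measurable borel" "g' \<in> borel_measurable borel" "level \<in> borel_measurable borel"
    unfolding f_def[abs_def] g'_def[abs_def] level_def[abs_def] by measurable
  have img: "level ` ?S = {0<..}"
  proof safe
    fix z :: real assume "z > 0"
    then show "z \<in> level ` ?S"
      using passage_range[of z] level_passage[of z] by (intro image_eqI[of _ _ "passage n1 n2 t z"]) auto
  qed (use level_pos in auto)
  have inj: "inj_on level ?S"
    by (rule inj_onI) (metis passage_level greaterThanLessThan_iff)
  have fi: "(\<lambda>z. indicator {0<..} z * f z) = f"
    by (auto simp: f_def half_normal_density_def indicator_def)
  have gf: "(\<lambda>y. indicator ?S y * (\<bar>g' y\<bar> * f (level y))) = (\<lambda>y. q_half_one n1 n2 y t * indicator A y)"
  proof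
    fix y
    show "indicator ?S y * (\<bar>g' y\<bar> * f (level y)) = q_half_one n1 n2 y t * indicator A y"
    proof (cases "y \<in> ?S")
      case True
      then have y: "0 < y" "y < t / n2" by auto
      have "t - n2 * y > 0" using y n2 by (simp add: field_simps)
      moreover have "t - n2 * y / 2 > 0"
        using calculation mult_pos_pos[OF n2 y(1)] by linarith
      ultimately have "g' y \<ge> 0" using n1 by (simp add: g'_def)
      then show ?thesis using y
        by (simp add: f_def q_half_one_level[folded g'_def] passage_level)
    qed (auto simp: q_half_one_def)
  qed
  have fint: "integrable lborel f"
    by (rule Bochner_Integration.integrable_bound[of _ half_normal_density])
      (use has_bochner_integral_half_normal_density in
        \<open>auto simp: has_bochner_integral_iff f_def indicator_def\<close>)
  then have "has_bochner_integral lborel (\<lambda>z. indicator (level ` ?S) z * f z) (integral\<^sup>L lborel f)"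
    unfolding img fi by (simp add: has_bochner_integral_iff)
  then have "has_bochner_integral lborel (\<lambda>y. indicator ?S y * (\<bar>g' y\<bar> * f (level y))) (integral\<^sup>L lborel f)"
    by (subst has_bochner_integral_change_of_variables)
      (use inj level_deriv in \<open>auto simp: img g'_def[abs_def]\<close>)
  then have q: "has_bochner_integral lborel (\<lambda>y. q_half_one n1 n2 y t * indicator A y) (integral\<^sup>L lborel f)"
    unfolding gf .
  have "emeasure (density lborel (\<lambda>y. ennreal (q_half_one n1 n2 y t))) A
      = (\<integral>\<^sup>+ y. ennreal (q_half_one n1 n2 y t * indicator A y) \<partial>lborel)"
    by (subst emeasure_density) (auto intro!: nn_integral_cong simp: indicator_def)
  also have "\<dots> = ennreal (integral\<^sup>L lborel f)"
    using q by (subst nn_integral_eq_integral) (auto simp: has_bochner_integral_iff q_half_one_nonneg)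
  also have "\<dots> = (\<integral>\<^sup>+ z. ennreal (f z) \<partial>lborel)"
    using fint by (subst nn_integral_eq_integral) (auto simp: f_def)
  also have "\<dots> = emeasure half_normal (passage n1 n2 t -` A)"
    unfolding half_normal_def
    by (subst emeasure_density) (auto intro!: nn_integral_cong simp: indicator_def f_def
        intro: measurable_sets_borel[OF measurable_passage])
  finally show "emeasure (distr half_normal borel (passage n1 n2 t)) A
      = emeasure (density lborel (\<lambda>y. ennreal (q_half_one n1 n2 y t))) A"
    by (subst emeasure_distr) auto
qed simp

lemma nn_integral_passage:
  assumes [measurable]: "F \<in> borel_measurable borel"
  shows "(\<integral>\<^sup>+ z. F (passage n1 n2 t z) \<partial>half_normal) = (\<integral>\<^sup>+ y. ennreal (q_half_one n1 n2 y t) * F y \<partial>lborel)"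
proof -
  have "(\<integral>\<^sup>+ z. F (passage n1 n2 t z) \<partial>half_normal)
      = (\<integral>\<^sup>+ y. F y \<partial>distr half_normal borel (passage n1 n2 t))"
    by (subst nn_integral_distr) auto
  then show ?thesis by (simp add: distr_passage nn_integral_density)
qed

lemma prob_space_q: "prob_space (density lborel (\<lambda>y. ennreal (q_half_one n1 n2 y t)))"
proof -
  interpret prob_space half_normal by (rule prob_space_half_normal)
  show ?thesis unfolding distr_passage[symmetric] by (rule prob_space_distr) simp
qed

end

end

section \<open>The initial condition\<close>

text \<open>At time \<open>t\<close> the mass lies in \<open>0 < y < t / n2\<close>, which shrinks
  to the origin. The limiting distribution function has its jump at 0, so \<open>x = 0\<close> is
  not a continuity point to be tested.\<close>

lemma delta_initial_q:
  assumes n1: "n1 > 0" and n2: "n2 > 0"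
  shows "delta_initial (q_half_one n1 n2)"
  unfolding delta_initial_def weak_conv_m_def weak_conv_def
proof (intro allI impI)
  fix \<tau> :: "nat \<Rightarrow> real" and x :: real
  assume pos: "\<forall>k. 0 < \<tau> k" and lim: "\<tau> \<longlonglongrightarrow> 0" and cont: "isCont (cdf (return borel 0)) x"
  let ?D = "\<lambda>k. density lborel (\<lambda>y. ennreal (q_half_one n1 n2 y (\<tau> k)))"
  have cdf0: "cdf (return borel 0) x = (if 0 \<le> x then 1 else 0)" for x :: real
    by (simp add: cdf_def measure_return indicator_def)
  have "x \<noteq> 0"
  proof
    assume "x = 0"
    interpret real_distribution "return borel (0::real)"
      by (auto simp: real_distribution_def real_distribution_axioms_def prob_space_return)
    show False using cont isCont_cdf[of x] \<open>x = 0\<close> by (simp add: measure_return)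
  qed
  then consider "x < 0" | "x > 0" by linarith
  then show "(\<lambda>k. cdf (?D k) x) \<longlonglongrightarrow> cdf (return borel 0) x"
  proof cases
    case 1
    have "emeasure (?D k) {..x} = 0" for k
      using 1 n1 n2
      by (subst emeasure_density) (auto intro!: nn_integral_zero' simp: q_half_one_def indicator_def
            measurable_q_half_one)
    then have "cdf (?D k) x = 0" for k by (simp add: cdf_def measure_def)
    then show ?thesis using 1 by (simp add: cdf0)
  next
    case 2
    \<comment> \<open>From here on the whole support lies below \<open>x\<close>, so the
      distribution function is exactly 1.\<close>
    have "\<forall>\<^sub>F k in sequentially. \<tau> k < n2 * x"
      using lim n2 2 by (intro order_tendstoD(2)[OF lim]) simp
    then have "\<forall>\<^sub>F k in sequentially. cdf (?D k) x = 1"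
    proof eventually_elim
      case (elim k)
      interpret prob_space "?D k" using n1 n2 pos by (intro prob_space_q) auto
      have "AE y in ?D k. y \<in> {..x}"
      proof (subst AE_density)
        show "AE y in lborel. 0 < ennreal (q_half_one n1 n2 y (\<tau> k)) \<longrightarrow> y \<in> {..x}"
        proof (rule AE_I2, rule impI)
          fix y assume "0 < ennreal (q_half_one n1 n2 y (\<tau> k))"
          then have "y < \<tau> k / n2" by (auto simp: q_half_one_def split: if_splits)
          also have "\<dots> < x" using elim n2 by (simp add: field_simps)
          finally show "y \<in> {..x}" by simp
        qed
      qed (use n1 n2 in \<open>simp add: measurable_q_half_one\<close>)
      then show ?case unfolding cdf_def by (subst prob_eq_1) auto
    qed
    then show ?thesis using 2 by (simp add: cdf0 tendsto_eventually)
  qed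
qed

section \<open>The relaxation equation\<close>

text \<open>The mean value inequality on the convex set \<open>T\<close> bounds all difference
  quotients by \<open>w\<close>, and dominated convergence applies along sequences. One exceptional
  null set serves all \<open>s\<close> at once.\<close>

lemma has_field_derivative_integral:
  fixes f f' :: "real \<Rightarrow> 'a \<Rightarrow> real"
  assumes T: "open T" "convex T" "t \<in> T"
    and int: "\<And>s. s \<in> T \<Longrightarrow> integrable M (f s)"
    and meas: "f' t \<in> borel_measurable M"
    and w: "integrable M w"
    and der: "AE z in M. \<forall>s\<in>T. ((\<lambda>s. f s z) has_field_derivative f' s z) (at s) \<and> \<bar>f' s z\<bar> \<le> w z"
  shows "((\<lambda>s. integral\<^sup>L M (f s)) has_field_derivative integral\<^sup>L M (f' t)) (at t)"
proof -
  have "((\<lambda>s. (integral\<^sup>L M (f s) - integral\<^sup>L M (f t)) / (s - t)) \<longlongrightarrow> integral\<^sup>L M (f' t)) (at t within T)"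
    unfolding tendsto_at_iff_sequentially
  proof (intro allI impI)
    fix X :: "nat \<Rightarrow> real" assume X: "\<forall>i. X i \<in> T - {t}" and lim: "X \<longlonglongrightarrow> t"
    have [measurable]: "f (X i) \<in> borel_measurable M" "f t \<in> borel_measurable M" for i
      using int X T by (auto intro!: borel_measurable_integrable)
    note meas [measurable]
    have "(\<lambda>i. \<integral>z. (f (X i) z - f t z) / (X i - t) \<partial>M) \<longlonglongrightarrow> integral\<^sup>L M (f' t)"
    proof (rule integral_dominated_convergence[where w = w])
      show "AE z in M. (\<lambda>i. (f (X i) z - f t z) / (X i - t)) \<longlonglongrightarrow> f' t z"
        using der
      proof eventually_elim
        case (elim z)
        then have "((\<lambda>s. (f s z - f t z) / (s - t)) \<longlongrightarrow> f' t z) (at t)"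
          using T by (auto simp: has_field_derivative_iff)
        from this[unfolded tendsto_at_iff_sequentially, rule_format, of X] show ?case
          using X lim by (auto simp: o_def)
      qed
      show "AE z in M. norm ((f (X i) z - f t z) / (X i - t)) \<le> w z" for i
        using der
      proof eventually_elim
        case (elim z)
        have "norm (f (X i) z - f t z) \<le> w z * norm (X i - t)"
          by (rule field_differentiable_bound[of T "\<lambda>s. f s z" "\<lambda>s. f' s z"])
            (use elim X T in \<open>auto intro: has_field_derivative_at_within\<close>)
        then show ?case using X by (simp add: norm_divide divide_le_eq)
      qed
    qed (use w in auto)
    moreover have "(\<integral>z. (f (X i) z - f t z) / (X i - t) \<partial>M) = (integral\<^sup>L M (f (X i)) - integral\<^sup>L M (f t)) / (X i - t)" for i
      using int[of "X i"] int[of t] X T by (simp add: Bochner_Integration.integral_diff)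
    ultimately show "((\<lambda>s. (integral\<^sup>L M (f s) - integral\<^sup>L M (f t)) / (s - t)) \<circ> X) \<longlonglongrightarrow> integral\<^sup>L M (f' t)"
      by (simp only: o_def)
  qed
  then show ?thesis
    by (simp only: has_field_derivative_iff at_within_open[OF T(3) T(1)])
qed

definition relax :: "real \<Rightarrow> real \<Rightarrow> real \<Rightarrow> real \<Rightarrow> real" where
  "relax lam n1 n2 t = (\<integral>z. exp (- lam * passage n1 n2 t z) \<partial>half_normal)"

text \<open>Expectation of \<open>exp (- lam * y)\<close> times the speed of
  \<open>y = passage n1 n2 t z\<close> in time. The factor \<open>- lam\<close> of the derivative is
  split off, so that for \<open>t \<ge> 0\<close> the integrand is nonnegative almost everywhere and
  Tonelli applies.\<close>

definition relax_rate :: "real \<Rightarrow> real \<Rightarrow> real \<Rightarrow> real \<Rightarrow> real" where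
  "relax_rate lam n1 n2 t =
     (\<integral>z. exp (- lam * passage n1 n2 t z) * (z / sqrt (n2\<^sup>2 * z\<^sup>2 + n1\<^sup>2 * t)) \<partial>half_normal)"

context
  fixes lam n1 n2 :: real
  assumes lam: "lam > 0" and n1: "n1 > 0" and n2: "n2 > 0"
begin

interpretation HN: prob_space half_normal by (rule prob_space_half_normal)

private lemma lam_passage_nonneg: "0 \<le> lam * passage n1 n2 t z" if "t \<ge> 0" "z > 0"
  using passage_nonneg[OF that(1) n2, of z n1] that lam by simp

private lemma exp_passage_le_1: "exp (- lam * passage n1 n2 t z) \<le> 1" if "t \<ge> 0" "z > 0"
  using lam_passage_nonneg[OF that] by simp

text \<open>The root dominates \<open>n2 * z\<close>. The resulting bound \<open>1 / n2\<close> is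
  uniform in \<open>z\<close> and \<open>t\<close>, so a constant dominates the differentiated
  integrand.\<close>

private lemma speed_le: "0 \<le> z / sqrt (n2\<^sup>2 * z\<^sup>2 + n1\<^sup>2 * t)" "z / sqrt (n2\<^sup>2 * z\<^sup>2 + n1\<^sup>2 * t) \<le> 1 / n2"
  if "t \<ge> 0" "z > 0"
proof -
  have "n2 * z = sqrt (n2\<^sup>2 * z\<^sup>2)" using that n2 by (simp add: real_sqrt_mult)
  also have "\<dots> \<le> sqrt (n2\<^sup>2 * z\<^sup>2 + n1\<^sup>2 * t)" using that by simp
  finally have *: "n2 * z \<le> sqrt (n2\<^sup>2 * z\<^sup>2 + n1\<^sup>2 * t)" .
  moreover have "0 < n2 * z" using that n2 by simp
  ultimately have "0 < sqrt (n2\<^sup>2 * z\<^sup>2 + n1\<^sup>2 * t)" by linarith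
  with * that n2 show "z / sqrt (n2\<^sup>2 * z\<^sup>2 + n1\<^sup>2 * t) \<le> 1 / n2"
    by (simp add: divide_le_eq le_divide_eq mult.commute)
  show "0 \<le> z / sqrt (n2\<^sup>2 * z\<^sup>2 + n1\<^sup>2 * t)" using that by simp
qed

private lemma rate_integrand_le:
  "exp (- lam * passage n1 n2 t z) * (z / sqrt (n2\<^sup>2 * z\<^sup>2 + n1\<^sup>2 * t)) \<le> 1 / n2"
  if "t \<ge> 0" "z > 0"
  using mult_mono[OF exp_passage_le_1[OF that] speed_le(2)[OF that]] speed_le(1)[OF that] by simp

private lemma integrable_exp_passage: "integrable half_normal (\<lambda>z. exp (- lam * passage n1 n2 t z))"
  if "t \<ge> 0"
  by (rule HN.integrable_const_bound[of _ 1])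
    (use AE_half_normal_pos that in \<open>auto elim!: eventually_mono intro: lam_passage_nonneg\<close>)

private lemma integrable_rate:
  "integrable half_normal (\<lambda>z. exp (- lam * passage n1 n2 t z) * (z / sqrt (n2\<^sup>2 * z\<^sup>2 + n1\<^sup>2 * t)))"
  if t: "t \<ge> 0"
proof (rule HN.integrable_const_bound[of _ "1 / n2"])
  show "AE z in half_normal. norm (exp (- lam * passage n1 n2 t z) * (z / sqrt (n2\<^sup>2 * z\<^sup>2 + n1\<^sup>2 * t))) \<le> 1 / n2"
    using AE_half_normal_pos
  proof eventually_elim
    case (elim z)
    have "0 \<le> exp (- lam * passage n1 n2 t z) * (z / sqrt (n2\<^sup>2 * z\<^sup>2 + n1\<^sup>2 * t))"
      by (intro mult_nonneg_nonneg speed_le(1)[OF t elim]) simp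
    with rate_integrand_le[OF t elim] show ?case by (simp only: real_norm_def abs_of_nonneg)
  qed
qed measurable

private lemma passage_deriv:
  assumes t: "t > 0"
  shows "((\<lambda>s. exp (- lam * passage n1 n2 s z)) has_field_derivative
     - lam * (exp (- lam * passage n1 n2 t z) * (z / sqrt (n2\<^sup>2 * z\<^sup>2 + n1\<^sup>2 * t)))) (at t)"
proof -
  have p: "n2\<^sup>2 * z\<^sup>2 + n1\<^sup>2 * t > 0" using t n1 by (intro add_nonneg_pos) auto
  have "((\<lambda>s. passage n1 n2 s z) has_field_derivative z / sqrt (n2\<^sup>2 * z\<^sup>2 + n1\<^sup>2 * t)) (at t)"
    unfolding passage_def using p n1
    by (auto intro!: derivative_eq_intros simp: field_simps)
  then show ?thesis
    by (auto intro!: derivative_eq_intros)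
qed

lemma relax_deriv: "(relax lam n1 n2 has_field_derivative - lam * relax_rate lam n1 n2 t) (at t)"
  if t: "t > 0"
proof -
  let ?d = "\<lambda>s z. - lam * (exp (- lam * passage n1 n2 s z) * (z / sqrt (n2\<^sup>2 * z\<^sup>2 + n1\<^sup>2 * s)))"
  have "((\<lambda>s. \<integral>z. exp (- lam * passage n1 n2 s z) \<partial>half_normal) has_field_derivative
      (\<integral>z. ?d t z \<partial>half_normal)) (at t)"
  proof (rule has_field_derivative_integral[where T = "{0<..}" and w = "\<lambda>_. lam * (1 / n2)" and f' = ?d])
    show "AE z in half_normal. \<forall>s\<in>{0<..}.
        ((\<lambda>s. exp (- lam * passage n1 n2 s z)) has_real_derivative ?d s z) (at s) \<and> \<bar>?d s z\<bar> \<le> lam * (1 / n2)"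
      using AE_half_normal_pos
    proof eventually_elim
      case (elim z)
      show ?case
      proof (intro ballI conjI)
        fix s :: real assume s: "s \<in> {0<..}"
        show "((\<lambda>s. exp (- lam * passage n1 n2 s z)) has_real_derivative ?d s z) (at s)"
          using s by (intro passage_deriv) simp
        have "\<bar>?d s z\<bar> = lam * (exp (- lam * passage n1 n2 s z) * (z / sqrt (n2\<^sup>2 * z\<^sup>2 + n1\<^sup>2 * s)))"
          using speed_le(1)[of s z] s elim lam by (simp add: abs_mult)
        also have "\<dots> \<le> lam * (1 / n2)"
          using rate_integrand_le[of s z] s elim lam by (intro mult_left_mono) auto
        finally show "\<bar>?d s z\<bar> \<le> lam * (1 / n2)" .
      qed
    qed
  qed (use t integrable_exp_passage in auto)
  then show ?thesis
    unfolding relax_def[abs_def] relax_rate_def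
    by (simp only: integral_mult_right_zero)
qed

lemma continuous_on_relax: "continuous_on {0..} (relax lam n1 n2)"
proof (rule continuous_on_sequentiallyI)
  fix X :: "nat \<Rightarrow> real" and t assume X: "\<forall>n. X n \<in> {0..}" "t \<in> {0..}" "X \<longlonglongrightarrow> t"
  show "(\<lambda>n. relax lam n1 n2 (X n)) \<longlonglongrightarrow> relax lam n1 n2 t"
    unfolding relax_def
  proof (rule integral_dominated_convergence[where w = "\<lambda>_. 1"])
    show "AE z in half_normal. (\<lambda>n. exp (- lam * passage n1 n2 (X n) z)) \<longlonglongrightarrow> exp (- lam * passage n1 n2 t z)"
      unfolding passage_def by (intro AE_I2 tendsto_intros X)
    show "AE z in half_normal. norm (exp (- lam * passage n1 n2 (X n) z)) \<le> 1" for n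
      using AE_half_normal_pos X(1) by (auto elim!: eventually_mono intro!: lam_passage_nonneg)
  qed auto
qed

lemma relax_0: "relax lam n1 n2 0 = 1"
proof -
  have "AE z in half_normal. exp (- lam * passage n1 n2 0 z) = 1"
    using AE_half_normal_pos by eventually_elim (simp add: n2)
  then have "relax lam n1 n2 0 = (\<integral>z. 1 \<partial>half_normal)"
    unfolding relax_def by (intro integral_cong_AE) auto
  then show ?thesis using HN.prob_space by simp
qed

lemma relax_rate_nonneg: "relax_rate lam n1 n2 t \<ge> 0" if "t \<ge> 0"
  unfolding relax_rate_def
  by (rule integral_nonneg_AE)
    (use AE_half_normal_pos that in \<open>auto elim!: eventually_mono\<close>)

lemma measurable_relax_rate [measurable]: "relax_rate lam n1 n2 \<in> borel_measurable borel"
  unfolding relax_rate_def[abs_def] by measurable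

section \<open>Integral representations in the space variable\<close>

text \<open>The expectation is transported along \<open>distr_passage\<close> and becomes the
  Laplace transform of the density. Nonnegative integrals are used so that they may be split and
  exchanged freely.\<close>

lemma relax_nn_integral:
  assumes t: "t > 0"
  shows "ennreal (relax lam n1 n2 t)
    = (\<integral>\<^sup>+ y. ennreal (q_half_one n1 n2 y t) * ennreal (exp (- lam * y)) \<partial>lborel)"
proof -
  have "ennreal (relax lam n1 n2 t) = (\<integral>\<^sup>+ z. ennreal (exp (- lam * passage n1 n2 t z)) \<partial>half_normal)"
    unfolding relax_def using t integrable_exp_passage[of t]
    by (subst nn_integral_eq_integral) auto
  then show ?thesis
    using nn_integral_passage[OF n1 n2 t, of "\<lambda>y. ennreal (exp (- lam * y))"] by simp
qed

text \<open>The speed is rewritten in \<open>y\<close> by \<open>passage_over_sqrt\<close>, and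
  multiplied by the density it is the stable kernel. So the derivative of the solution is a mixture
  of shifted kernels with known half integrals.\<close>

lemma relax_rate_nn_integral:
  assumes t: "t > 0"
  shows "ennreal (relax_rate lam n1 n2 t) = (\<integral>\<^sup>+ y. ennreal (indicator {0<..} y *
      (exp (- lam * y) * levy_density (n1 * y / 2) (t - n2 * y))) \<partial>lborel)"
proof -
  define F where "F y = ennreal (exp (- lam * y) * (y / (2 * t - n2 * y)))" for y
  have [measurable]: "F \<in> borel_measurable borel" unfolding F_def[abs_def] by measurable
  have "ennreal (relax_rate lam n1 n2 t)
      = (\<integral>\<^sup>+ z. ennreal (exp (- lam * passage n1 n2 t z) * (z / sqrt (n2\<^sup>2 * z\<^sup>2 + n1\<^sup>2 * t))) \<partial>half_normal)"
    unfolding relax_rate_def using t integrable_rate[of t]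
    by (subst nn_integral_eq_integral)
      (use AE_half_normal_pos in \<open>auto elim!: eventually_mono\<close>)
  also have "\<dots> = (\<integral>\<^sup>+ z. F (passage n1 n2 t z) \<partial>half_normal)"
  proof (rule nn_integral_cong_AE)
    show "AE z in half_normal. ennreal (exp (- lam * passage n1 n2 t z) *
        (z / sqrt (n2\<^sup>2 * z\<^sup>2 + n1\<^sup>2 * t))) = F (passage n1 n2 t z)"
      using AE_half_normal_pos
      by eventually_elim (simp only: F_def passage_over_sqrt[OF n1 n2 t])
  qed
  also have "\<dots> = (\<integral>\<^sup>+ y. ennreal (q_half_one n1 n2 y t) * F y \<partial>lborel)"
    by (intro nn_integral_passage n1 n2 t) simp
  also have "\<dots> = (\<integral>\<^sup>+ y. ennreal (indicator {0<..} y *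
      (exp (- lam * y) * levy_density (n1 * y / 2) (t - n2 * y))) \<partial>lborel)"
  proof (rule nn_integral_cong)
    fix y
    consider "y \<le> 0" | "y \<ge> t / n2" "y > 0" | "0 < y" "y < t / n2" by linarith
    then show "ennreal (q_half_one n1 n2 y t) * F y = ennreal (indicator {0<..} y *
      (exp (- lam * y) * levy_density (n1 * y / 2) (t - n2 * y)))"
    proof cases
      case 3
      then show ?thesis
        using q_half_one_nonneg[OF n1 n2, of y t]
        by (simp add: F_def levy_density_eq_q[OF n1 n2 t] ennreal_mult'[symmetric] mult_ac)
    qed (use n2 in \<open>auto simp: q_half_one_def levy_density_def field_simps\<close>)
  qed
  finally show ?thesis .
qed

text \<open>The witness \<open>g\<close> is the integral over \<open>y > 0\<close> of
  \<open>exp (- lam * y)\<close> against the Gaussian kernel. Its first property is the Abel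
  identity for \<open>levy_density\<close> under the integral over \<open>y\<close>; its second is
  the kernel decomposition of the density, integrated.\<close>

lemma abel_relax_rate:
  assumes t: "t > 0"
  obtains g where
    "has_bochner_integral lborel (\<lambda>s. indicator {0<..<t} s * ((t - s) powr (-1/2) * relax_rate lam n1 n2 s)) (sqrt pi * g)"
    "relax lam n1 n2 t = n1 * g + n2 * relax_rate lam n1 n2 t"
proof -
  let ?L = "\<lambda>s y. levy_density (n1 * y / 2) (s - n2 * y)"
  let ?A = "\<lambda>y. abel_gauss (n1 * y / 2) (t - n2 * y)"
  define G where "G = (\<integral>\<^sup>+ y. ennreal (indicator {0<..} y * (exp (- lam * y) * ?A y)) \<partial>lborel)"
  have Lnn: "?L s y \<ge> 0" if "y > 0" for s y using that n1 by (simp add: levy_density_def)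
  have Ann: "?A y \<ge> 0" for y by (simp add: abel_gauss_def)
  have "ennreal (relax lam n1 n2 t)
    = (\<integral>\<^sup>+ y. ennreal n1 * ennreal (indicator {0<..} y * (exp (- lam * y) * ?A y))
         + ennreal n2 * ennreal (indicator {0<..} y * (exp (- lam * y) * ?L t y)) \<partial>lborel)"
    unfolding relax_nn_integral[OF t]
  proof (rule nn_integral_cong)
    fix y
    show "ennreal (q_half_one n1 n2 y t) * ennreal (exp (- lam * y)) =
         ennreal n1 * ennreal (indicator {0<..} y * (exp (- lam * y) * ?A y))
         + ennreal n2 * ennreal (indicator {0<..} y * (exp (- lam * y) * ?L t y))"
    proof (cases "y > 0")
      case True
      then show ?thesis using n1 n2 Ann[of y] Lnn[of y t]
        by (simp add: q_half_one_kernels[OF n2] ennreal_mult'[symmetric] ennreal_plus[symmetric]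
            algebra_simps del: ennreal_plus)
    qed (simp add: q_half_one_def)
  qed
  also have "\<dots> = ennreal n1 * G + ennreal n2 * ennreal (relax_rate lam n1 n2 t)"
    unfolding relax_rate_nn_integral[OF t] G_def
    by (subst nn_integral_add) (auto simp: nn_integral_cmult)
  finally have eq: "ennreal (relax lam n1 n2 t) = ennreal n1 * G + ennreal n2 * ennreal (relax_rate lam n1 n2 t)" .
  \<comment> \<open>The left side of \<open>eq\<close> is finite and \<open>n1 > 0\<close>.\<close>
  have "G \<noteq> \<top>"
  proof
    assume "G = \<top>"
    with eq n1 show False by (simp add: ennreal_mult_top)
  qed
  then obtain g where g: "g \<ge> 0" "G = ennreal g" by (cases G) auto
  have "(\<integral>\<^sup>+ s. ennreal (indicator {0<..<t} s * ((t - s) powr (-1/2) * relax_rate lam n1 n2 s)) \<partial>lborel)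
     = (\<integral>\<^sup>+ s. (\<integral>\<^sup>+ y. ennreal (indicator {0<..} y * exp (- lam * y)) *
          ennreal (indicator {0<..<t} s * ((t - s) powr (-1/2) * ?L s y)) \<partial>lborel) \<partial>lborel)"
  proof (rule nn_integral_cong)
    fix s
    show "ennreal (indicator {0<..<t} s * ((t - s) powr (-1/2) * relax_rate lam n1 n2 s))
      = (\<integral>\<^sup>+ y. ennreal (indicator {0<..} y * exp (- lam * y)) *
          ennreal (indicator {0<..<t} s * ((t - s) powr (-1/2) * ?L s y)) \<partial>lborel)"
    proof (cases "s \<in> {0<..<t}")
      case True
      then have "ennreal (indicator {0<..<t} s * ((t - s) powr (-1/2) * relax_rate lam n1 n2 s))
        = ennreal ((t - s) powr (-1/2)) * ennreal (relax_rate lam n1 n2 s)"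
        by (simp add: ennreal_mult')
      also have "\<dots> = ennreal ((t - s) powr (-1/2)) * (\<integral>\<^sup>+ y. ennreal (indicator {0<..} y *
      (exp (- lam * y) * ?L s y)) \<partial>lborel)"
        using True by (subst relax_rate_nn_integral) auto
      also have "\<dots> = (\<integral>\<^sup>+ y. ennreal ((t - s) powr (-1/2)) * ennreal (indicator {0<..} y *
      (exp (- lam * y) * ?L s y)) \<partial>lborel)"
        by (subst nn_integral_cmult) auto
      also have "\<dots> = (\<integral>\<^sup>+ y. ennreal (indicator {0<..} y * exp (- lam * y)) *
          ennreal (indicator {0<..<t} s * ((t - s) powr (-1/2) * ?L s y)) \<partial>lborel)"
        using True by (intro nn_integral_cong) (auto simp: indicator_def ennreal_mult'[symmetric] mult_ac)
      finally show ?thesis .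
    qed simp
  qed
  \<comment> \<open>Tonelli; the inner integral is now the half integral of one shifted
    kernel.\<close>
  also have "\<dots> = (\<integral>\<^sup>+ y. (\<integral>\<^sup>+ s. ennreal (indicator {0<..} y * exp (- lam * y)) *
          ennreal (indicator {0<..<t} s * ((t - s) powr (-1/2) * ?L s y)) \<partial>lborel) \<partial>lborel)"
    by (rule lborel_pair.Fubini') measurable
  also have "\<dots> = (\<integral>\<^sup>+ y. ennreal (sqrt pi) * ennreal (indicator {0<..} y * (exp (- lam * y) * ?A y)) \<partial>lborel)"
  proof (rule nn_integral_cong)
    fix y
    show "(\<integral>\<^sup>+ s. ennreal (indicator {0<..} y * exp (- lam * y)) *
          ennreal (indicator {0<..<t} s * ((t - s) powr (-1/2) * ?L s y)) \<partial>lborel)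
       = ennreal (sqrt pi) * ennreal (indicator {0<..} y * (exp (- lam * y) * ?A y))"
    proof (cases "y > 0")
      case True
      have "has_bochner_integral lborel (\<lambda>s. indicator {0<..<t} s * ((t - s) powr (-1/2) * ?L s y)) (sqrt pi * ?A y)"
        using True n1 n2 by (intro abel_shifted_kernels) auto
      then have "(\<integral>\<^sup>+ s. ennreal (indicator {0<..<t} s * ((t - s) powr (-1/2) * ?L s y)) \<partial>lborel) = ennreal (sqrt pi * ?A y)"
        by (subst nn_integral_eq_integral) (use True Lnn in \<open>auto simp: has_bochner_integral_iff\<close>)
      then show ?thesis using True Ann[of y]
        by (subst nn_integral_cmult) (auto simp: ennreal_mult'[symmetric] mult_ac)
    qed simp
  qed
  also have "\<dots> = ennreal (sqrt pi * g)"
    using g unfolding G_def by (subst nn_integral_cmult) (auto simp: ennreal_mult')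
  finally have "has_bochner_integral lborel (\<lambda>s. indicator {0<..<t} s * ((t - s) powr (-1/2) * relax_rate lam n1 n2 s)) (sqrt pi * g)"
    by (intro has_bochner_integral_nn_integral)
      (use g relax_rate_nonneg in \<open>auto simp: indicator_def\<close>)
  moreover have "ennreal (relax lam n1 n2 t) = ennreal (n1 * g + n2 * relax_rate lam n1 n2 t)"
    using eq g n1 n2 t relax_rate_nonneg[of t]
    by (simp add: ennreal_mult'[symmetric] ennreal_plus[symmetric] del: ennreal_plus)
  then have "relax lam n1 n2 t = n1 * g + n2 * relax_rate lam n1 n2 t"
    using g n1 n2 t relax_rate_nonneg[of t]
    by (subst (asm) ennreal_inj) (auto simp: relax_def)
  ultimately show ?thesis by (rule that)
qed

text \<open>The derivative is \<open>- lam\<close> times \<open>relax_rate\<close> and the Caputo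
  derivative is \<open>- lam * g\<close>, so the second property of \<open>g\<close> in
  \<open>abel_relax_rate\<close> is the equation.\<close>

lemma relaxation_solution_relax: "relaxation_solution lam n1 n2 (relax lam n1 n2)"
  unfolding relaxation_solution_def
proof (intro conjI allI impI continuous_on_relax relax_0)
  fix t :: real assume t: "t > 0"
  have fd: "relax lam n1 n2 field_differentiable at s" if "s > 0" for s
    using relax_deriv[OF that] unfolding field_differentiable_def by blast
  show "relax lam n1 n2 field_differentiable at t" using fd[OF t] .
  have d: "deriv (relax lam n1 n2) s = - lam * relax_rate lam n1 n2 s" if "s > 0" for s
    by (intro DERIV_imp_deriv relax_deriv that)
  obtain g where g: "has_bochner_integral lborel
       (\<lambda>s. indicator {0<..<t} s * ((t - s) powr (-1/2) * relax_rate lam n1 n2 s)) (sqrt pi * g)"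
    "relax lam n1 n2 t = n1 * g + n2 * relax_rate lam n1 n2 t"
    using abel_relax_rate[OF t] .
  have "has_bochner_integral lborel
       (\<lambda>s. - lam * (indicator {0<..<t} s * ((t - s) powr (-1/2) * relax_rate lam n1 n2 s))) (- lam * (sqrt pi * g))"
    by (intro has_bochner_integral_mult_right g)
  also have "(\<lambda>s. - lam * (indicator {0<..<t} s * ((t - s) powr (-1/2) * relax_rate lam n1 n2 s)))
    = (\<lambda>s. indicator {0<..<t} s *\<^sub>R ((t - s) powr (-1/2) * deriv (relax lam n1 n2) s))"
    by (auto simp: fun_eq_iff indicator_def d)
  finally have I: "has_bochner_integral lborel
    (\<lambda>s. indicator {0<..<t} s *\<^sub>R ((t - s) powr (-1/2) * deriv (relax lam n1 n2) s)) (- lam * (sqrt pi * g))" .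
  show "caputo_half_exists (relax lam n1 n2) t"
    unfolding caputo_half_exists_def set_integrable_def
    using I fd by (auto simp: has_bochner_integral_iff)
  have "caputo_half (relax lam n1 n2) t = - lam * g"
    unfolding caputo_half_def set_lebesgue_integral_def
    using I by (simp add: has_bochner_integral_iff Gamma_one_half_real)
  then show "n1 * caputo_half (relax lam n1 n2) t + n2 * deriv (relax lam n1 n2) t = - lam * relax lam n1 n2 t"
    by (simp add: d[OF t] g(2) algebra_simps)
qed

end

section \<open>Uniqueness of the solution\<close>

text \<open>A weight \<open>exp (- \<mu> t)\<close> with large \<open>\<mu>\<close> makes convolution with \<open>K\<close> a strict contraction on \<open>L\<^sup>1\<close>.\<close>

lemma exponential_weight_small:
  fixes K :: "real \<Rightarrow> real"
  assumes K: "integrable lborel (\<lambda>u. indicator {0<..<T} u * K u)"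
  obtains \<mu> :: real where "\<mu> > 0" "(\<integral>\<^sup>+ u. ennreal (indicator {0<..<T} u * \<bar>K u\<bar> * exp (- \<mu> * u)) \<partial>lborel) < 1"
proof -
  have m [measurable]: "(\<lambda>u. indicator {0<..<T} u * K u) \<in> borel_measurable borel"
    using borel_measurable_integrable[OF K] by simp
  have abs_eq: "indicator {0<..<T} u * \<bar>K u\<bar> = \<bar>indicator {0<..<T} u * K u\<bar>" for u
    by (simp add: indicator_def)
  have m' [measurable]: "(\<lambda>u. indicator {0<..<T} u * \<bar>K u\<bar>) \<in> borel_measurable borel"
    unfolding abs_eq by measurable
  \<comment> \<open>Dominated convergence along integer weights: for \<open>u > 0\<close> the
    exponential tends to 0, and the truncated kernel dominates.\<close>
  have "(\<lambda>n. LBINT u. indicator {0<..<T} u * \<bar>K u\<bar> * exp (- real n * u)) \<longlonglongrightarrow> integral\<^sup>L lborel (\<lambda>_::real. 0)"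
  proof (rule integral_dominated_convergence[where w = "\<lambda>u. norm (indicator {0<..<T} u * K u)"])
    show "integrable lborel (\<lambda>u. norm (indicator {0<..<T} u * K u))" using K by (rule integrable_norm)
    show "AE u in lborel. norm (indicator {0<..<T} u * \<bar>K u\<bar> * exp (- real n * u))
        \<le> norm (indicator {0<..<T} u * K u)" for n
      by (rule AE_I2) (auto simp: indicator_def abs_mult intro!: mult_left_le)
    show "AE u in lborel. (\<lambda>n. indicator {0<..<T} u * \<bar>K u\<bar> * exp (- real n * u)) \<longlonglongrightarrow> 0"
    proof (rule AE_I2)
      fix u :: real
      show "(\<lambda>n. indicator {0<..<T} u * \<bar>K u\<bar> * exp (- real n * u)) \<longlonglongrightarrow> 0"
      proof (cases "u > 0")
        case True
        have "(\<lambda>n. exp (- u) ^ n) \<longlonglongrightarrow> 0" using True by (intro LIMSEQ_power_zero) simp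
        then have "(\<lambda>n. exp (- real n * u)) \<longlonglongrightarrow> 0"
          by (simp add: exp_of_nat_mult[symmetric] mult.commute)
        then show ?thesis by (intro tendsto_mult_right_zero)
      qed simp
    qed
  qed auto
  then have "\<forall>\<^sub>F n in sequentially. (LBINT u. indicator {0<..<T} u * \<bar>K u\<bar> * exp (- real n * u)) < 1"
    by (intro order_tendstoD(2)[of _ 0]) auto
  then have "\<forall>\<^sub>F n in sequentially. n > 0 \<and> (LBINT u. indicator {0<..<T} u * \<bar>K u\<bar> * exp (- real n * u)) < 1"
    using eventually_gt_at_top[of "0::nat"] by eventually_elim auto
  then obtain n where n: "n > 0" "(LBINT u. indicator {0<..<T} u * \<bar>K u\<bar> * exp (- real n * u)) < 1"
    by (auto simp: eventually_sequentially)
  have "integrable lborel (\<lambda>u. indicator {0<..<T} u * \<bar>K u\<bar> * exp (- real n * u))"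
  proof (rule Bochner_Integration.integrable_bound[OF K])
    show "AE u in lborel. norm (indicator {0<..<T} u * \<bar>K u\<bar> * exp (- real n * u))
        \<le> norm (indicator {0<..<T} u * K u)"
      by (rule AE_I2) (auto simp: indicator_def abs_mult intro!: mult_left_le)
  qed measurable
  then have "(\<integral>\<^sup>+ u. ennreal (indicator {0<..<T} u * \<bar>K u\<bar> * exp (- real n * u)) \<partial>lborel) < 1"
    using n(2) by (subst nn_integral_eq_integral) (auto simp: ennreal_less_one_iff)
  then show ?thesis using n(1) by (intro that[of "real n"]) auto
qed

text \<open>\<open>V\<close> is the \<open>L^1\<close> norm of the truncated \<open>w\<close> with
  weight \<open>exp (- \<mu> * t)\<close>. The inequality gives \<open>V \<le> q * V\<close> with
  \<open>q < 1\<close>, and as \<open>V\<close> is finite it is 0. Stating the bound in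
  \<open>ennreal\<close> allows the convolution to be infinite at some times.\<close>

lemma volterra_inequality_imp_null:
  fixes w K :: "real \<Rightarrow> real"
  assumes w: "integrable lborel (\<lambda>t. indicator {0<..<T} t * w t)" and w0: "\<And>t. w t \<ge> 0"
    and K: "integrable lborel (\<lambda>u. indicator {0<..<T} u * K u)" and K0: "\<And>u. K u \<ge> 0"
    and le: "\<And>t. t \<in> {0<..<T} \<Longrightarrow>
       ennreal (w t) \<le> (\<integral>\<^sup>+ s. ennreal (indicator {0<..<t} s * (K (t - s) * w s)) \<partial>lborel)"
  shows "AE t in lborel. indicator {0<..<T} t * w t = 0"
proof -
  obtain \<mu> where \<mu>: "\<mu> > 0" "(\<integral>\<^sup>+ u. ennreal (indicator {0<..<T} u * \<bar>K u\<bar> * exp (- \<mu> * u)) \<partial>lborel) < 1"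
    using exponential_weight_small[OF K] .
  define W where "W t = indicator {0<..<T} t * w t" for t
  define k where "k u = indicator {0<..<T} u * K u" for u
  have [measurable]: "W \<in> borel_measurable borel" "k \<in> borel_measurable borel"
    using borel_measurable_integrable[OF w] borel_measurable_integrable[OF K]
    by (simp_all add: W_def[abs_def] k_def[abs_def])
  have W0: "W t \<ge> 0" "k t \<ge> 0" for t by (simp_all add: W_def k_def w0 K0)
  define V where "V = (\<integral>\<^sup>+ t. ennreal (exp (- \<mu> * t) * W t) \<partial>lborel)"
  define q where "q = (\<integral>\<^sup>+ u. ennreal (k u * exp (- \<mu> * u)) \<partial>lborel)"
  have q1: "q < 1" using \<mu>(2) by (simp add: q_def k_def K0)
  have V: "V < \<top>"
  proof -
    have "V \<le> (\<integral>\<^sup>+ t. ennreal (W t) \<partial>lborel)" unfolding V_def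
    proof (intro nn_integral_mono ennreal_leI)
      fix t show "exp (- \<mu> * t) * W t \<le> W t"
        using \<mu>(1) w0[of t] by (auto simp: W_def indicator_def intro!: mult_left_le_one_le)
    qed
    also have "\<dots> < \<top>"
      using w W0 by (subst nn_integral_eq_integral) (auto simp: W_def[abs_def])
    finally show ?thesis .
  qed
  \<comment> \<open>Truncation of kernel and function loses nothing, since
    \<open>0 < s < t < T\<close> puts \<open>t - s\<close> between 0 and \<open>T\<close>.\<close>
  have W_le: "ennreal (W t) \<le> (\<integral>\<^sup>+ s. ennreal (k (t - s) * W s) \<partial>lborel)" for t
  proof (cases "t \<in> {0<..<T}")
    case True
    then have "ennreal (W t) \<le> (\<integral>\<^sup>+ s. ennreal (indicator {0<..<t} s * (K (t - s) * w s)) \<partial>lborel)"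
      using le by (simp add: W_def)
    also have "\<dots> \<le> (\<integral>\<^sup>+ s. ennreal (k (t - s) * W s) \<partial>lborel)"
      using True w0 K0 by (intro nn_integral_mono ennreal_leI) (auto simp: indicator_def k_def W_def)
    finally show ?thesis .
  qed (simp add: W_def)
  have "V \<le> (\<integral>\<^sup>+ t. (\<integral>\<^sup>+ s. ennreal (exp (- \<mu> * t)) * ennreal (k (t - s) * W s) \<partial>lborel) \<partial>lborel)"
    unfolding V_def
  proof (rule nn_integral_mono)
    fix t
    have "ennreal (exp (- \<mu> * t) * W t) = ennreal (exp (- \<mu> * t)) * ennreal (W t)"
      by (rule ennreal_mult') simp
    also have "\<dots> \<le> ennreal (exp (- \<mu> * t)) * (\<integral>\<^sup>+ s. ennreal (k (t - s) * W s) \<partial>lborel)"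
      by (intro mult_left_mono W_le) simp
    also have "\<dots> = (\<integral>\<^sup>+ s. ennreal (exp (- \<mu> * t)) * ennreal (k (t - s) * W s) \<partial>lborel)"
      by (subst nn_integral_cmult) auto
    finally show "ennreal (exp (- \<mu> * t) * W t) \<le> (\<integral>\<^sup>+ s. ennreal (exp (- \<mu> * t)) * ennreal (k (t - s) * W s) \<partial>lborel)" .
  qed
  also have "\<dots> = (\<integral>\<^sup>+ s. (\<integral>\<^sup>+ t. ennreal (exp (- \<mu> * t)) * ennreal (k (t - s) * W s) \<partial>lborel) \<partial>lborel)"
    by (rule lborel_pair.Fubini') measurable
  \<comment> \<open>The weight is multiplicative: with \<open>t = s + u\<close> it splits into a
    factor in \<open>u\<close>, integrated to \<open>q\<close>, and a factor in
    \<open>s\<close>.\<close>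
  also have "\<dots> = (\<integral>\<^sup>+ s. q * ennreal (exp (- \<mu> * s) * W s) \<partial>lborel)"
  proof (rule nn_integral_cong)
    fix s
    have "(\<integral>\<^sup>+ t. ennreal (exp (- \<mu> * t)) * ennreal (k (t - s) * W s) \<partial>lborel)
       = (\<integral>\<^sup>+ u. ennreal (exp (- \<mu> * (s + u))) * ennreal (k u * W s) \<partial>lborel)"
      using nn_integral_real_affine[of "\<lambda>t. ennreal (exp (- \<mu> * t)) * ennreal (k (t - s) * W s)" 1 s]
      by simp
    also have "\<dots> = (\<integral>\<^sup>+ u. ennreal (k u * exp (- \<mu> * u)) * ennreal (exp (- \<mu> * s) * W s) \<partial>lborel)"
    proof (rule nn_integral_cong)
      fix u
      have "exp (- \<mu> * (s + u)) = exp (- \<mu> * u) * exp (- \<mu> * s)"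
        by (simp add: exp_add[symmetric] algebra_simps)
      then show "ennreal (exp (- \<mu> * (s + u))) * ennreal (k u * W s)
          = ennreal (k u * exp (- \<mu> * u)) * ennreal (exp (- \<mu> * s) * W s)"
        using W0(1)[of s] W0(2)[of u] by (simp add: ennreal_mult'[symmetric] mult_ac)
    qed
    also have "\<dots> = q * ennreal (exp (- \<mu> * s) * W s)"
      unfolding q_def by (rule nn_integral_multc) simp
    finally show "(\<integral>\<^sup>+ t. ennreal (exp (- \<mu> * t)) * ennreal (k (t - s) * W s) \<partial>lborel)
      = q * ennreal (exp (- \<mu> * s) * W s)" .
  qed
  also have "\<dots> = q * V" unfolding V_def by (rule nn_integral_cmult) simp
  finally have "V \<le> q * V" .
  have "V = 0"
  proof (rule ccontr)
    assume "V \<noteq> 0"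
    then have "q * V < 1 * V" using q1 V
      by (intro ennreal_mult_strict_right_mono) (auto simp: zero_less_iff_neq_zero)
    with \<open>V \<le> q * V\<close> show False by simp
  qed
  then have "AE t in lborel. ennreal (exp (- \<mu> * t) * W t) = 0"
    unfolding V_def by (subst (asm) nn_integral_0_iff_AE) auto
  then show ?thesis
  proof eventually_elim
    case (elim t)
    then have "exp (- \<mu> * t) * W t \<le> 0" by (simp add: ennreal_eq_0_iff)
    then have "W t \<le> 0" by (simp add: mult_le_0_iff)
    then show ?case using W0(1)[of t] by (simp add: W_def)
  qed
qed

lemma integrable_inverse_sqrt: "integrable lborel (\<lambda>u::real. indicator {0<..<T} u * (1 / sqrt u))" if "T > 0"
proof -
  have "(\<lambda>u::real. u powr (-1/2)) integrable_on {0<..T}"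
    using that by (intro integrable_on_powr_from_0') auto
  then have "(\<lambda>u::real. u powr (-1/2)) absolutely_integrable_on {0<..T}"
    by (intro nonnegative_absolutely_integrable_1) auto
  then have "(\<lambda>u::real. u powr (-1/2)) absolutely_integrable_on {0<..<T}"
    by (rule set_integrable_subset) auto
  then have "integrable lebesgue (\<lambda>u::real. indicator {0<..<T} u * u powr (-1/2))"
    by (simp add: set_integrable_def)
  then have "integrable lborel (\<lambda>u::real. indicator {0<..<T} u * u powr (-1/2))"
    by (subst (asm) integrable_completion) auto
  also have "(\<lambda>u::real. indicator {0<..<T} u * u powr (-1/2)) = (\<lambda>u. indicator {0<..<T} u * (1 / sqrt u))"
    using powr_minus_half by (auto simp: fun_eq_iff indicator_def)
  finally show ?thesis .
qed

text \<open>The difference \<open>d\<close> is the integral of its derivative, so the equation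
  bounds \<open>\<bar>d'\<bar>\<close> by a Volterra convolution of itself. Then \<open>d'\<close>
  vanishes almost everywhere and integrating it back gives \<open>d = 0\<close>.\<close>

lemma relaxation_solution_unique:
  fixes lam n1 n2 :: real
  assumes lam: "lam > 0" and n1: "n1 > 0" and n2: "n2 > 0"
    and \<phi>: "relaxation_solution lam n1 n2 \<phi>" and \<psi>: "relaxation_solution lam n1 n2 \<psi>"
    and t0: "t0 \<ge> 0"
  shows "\<phi> t0 = \<psi> t0"
proof -
  define d where "d t = \<phi> t - \<psi> t" for t
  define d' where "d' t = deriv \<phi> t - deriv \<psi> t" for t
  have d0: "d 0 = 0" using \<phi> \<psi> by (simp add: d_def relaxation_solution_def)
  have cont: "continuous_on {0..} d"
    using \<phi> \<psi> unfolding d_def[abs_def] relaxation_solution_def by (intro continuous_on_diff) auto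
  have der: "(d has_field_derivative d' t) (at t)" if "t > 0" for t
    using \<phi> \<psi> that unfolding d_def[abs_def] d'_def relaxation_solution_def
    by (intro DERIV_diff) (auto simp: field_differentiable_derivI)
  have int: "integrable lborel (\<lambda>s. indicator {0<..<t} s * ((t - s) powr (-1/2) * d' s))" if "t > 0" for t
  proof -
    have "set_integrable lborel {0<..<t} (\<lambda>s. (t - s) powr (-1/2) * deriv \<phi> s - (t - s) powr (-1/2) * deriv \<psi> s)"
      using \<phi> \<psi> that unfolding relaxation_solution_def caputo_half_exists_def
      by (intro set_integral_diff) auto
    then show ?thesis by (simp add: set_integrable_def d'_def right_diff_distrib)
  qed
  have eq: "n1 / sqrt pi * (LBINT s. indicator {0<..<t} s * ((t - s) powr (-1/2) * d' s)) + n2 * d' t = - lam * d t"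
    if t: "t > 0" for t
  proof -
    have "(LBINT s:{0<..<t}. (t - s) powr (-1/2) * deriv \<phi> s - (t - s) powr (-1/2) * deriv \<psi> s)
       = (LBINT s:{0<..<t}. (t - s) powr (-1/2) * deriv \<phi> s) - (LBINT s:{0<..<t}. (t - s) powr (-1/2) * deriv \<psi> s)"
      using \<phi> \<psi> t unfolding relaxation_solution_def caputo_half_exists_def
      by (intro set_integral_diff) auto
    then have I: "(LBINT s. indicator {0<..<t} s * ((t - s) powr (-1/2) * d' s))
       = sqrt pi * (caputo_half \<phi> t - caputo_half \<psi> t)"
      by (simp add: caputo_half_def Gamma_one_half_real set_lebesgue_integral_def d'_def right_diff_distrib)
    have "n1 * caputo_half \<phi> t + n2 * deriv \<phi> t = - lam * \<phi> t"
      "n1 * caputo_half \<psi> t + n2 * deriv \<psi> t = - lam * \<psi> t"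
      using \<phi> \<psi> t unfolding relaxation_solution_def by auto
    then show ?thesis unfolding I by (simp add: d_def d'_def algebra_simps)
  qed
  \<comment> \<open>Integrability in the Caputo sense controls \<open>d'\<close> itself up to time
    0, because \<open>1 / sqrt (t - s) \<ge> 1 / sqrt t\<close>.\<close>
  have int': "integrable lborel (\<lambda>s. indicator {0<..<t} s * d' s)" if t: "t > 0" for t
  proof (rule Bochner_Integration.integrable_bound)
    show "integrable lborel (\<lambda>s. sqrt t * (indicator {0<..<t} s * ((t - s) powr (-1/2) * d' s)))"
      using int[OF t] by simp
    have "(\<lambda>s. (indicator {0<..<t} s * ((t - s) powr (-1/2) * d' s)) * sqrt (t - s)) \<in> borel_measurable lborel"
      using borel_measurable_integrable[OF int[OF t]] by measurable
    also have "(\<lambda>s. (indicator {0<..<t} s * ((t - s) powr (-1/2) * d' s)) * sqrt (t - s)) = (\<lambda>s. indicator {0<..<t} s * d' s)"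
      using powr_minus_half by (auto simp: fun_eq_iff indicator_def)
    finally show "(\<lambda>s. indicator {0<..<t} s * d' s) \<in> borel_measurable lborel" .
    show "AE s in lborel. norm (indicator {0<..<t} s * d' s)
       \<le> norm (sqrt t * (indicator {0<..<t} s * ((t - s) powr (-1/2) * d' s)))"
    proof (rule AE_I2)
      fix s
      show "norm (indicator {0<..<t} s * d' s) \<le> norm (sqrt t * (indicator {0<..<t} s * ((t - s) powr (-1/2) * d' s)))"
      proof (cases "s \<in> {0<..<t}")
        case True
        then have "1 \<le> sqrt t * (1 / sqrt (t - s))" by simp
        then have "1 * \<bar>d' s\<bar> \<le> (sqrt t * (1 / sqrt (t - s))) * \<bar>d' s\<bar>" by (intro mult_right_mono) auto
        then show ?thesis using True powr_minus_half[of "t - s"] by (simp add: abs_mult)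
      qed simp
    qed
  qed
  \<comment> \<open>Derivatives are given on the open half line; continuity at 0 supplies the
    endpoint. By \<open>int'\<close> the gauge integral is a Lebesgue integral.\<close>
  have ftc: "d t = (LBINT s. indicator {0<..<t} s * d' s)" if t: "t > 0" for t
  proof -
    have "(d' has_integral (d t - d 0)) {0..t}"
      using t der continuous_on_subset[OF cont]
      by (intro fundamental_theorem_of_calculus_interior)
        (auto simp: has_real_derivative_iff_has_vector_derivative)
    then have "(d' has_integral d t) {0<..<t}"
      by (simp add: d0 has_integral_Icc_iff_Ioo)
    moreover have "set_integrable lborel {0<..<t} d'"
      using int'[OF t] by (simp add: set_integrable_def)
    from set_borel_integral_eq_integral[OF this]
    have "(d' has_integral (LBINT s. indicator {0<..<t} s * d' s)) {0<..<t}"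
      by (simp add: set_lebesgue_integral_def has_integral_integrable_integral)
    ultimately show ?thesis by (rule has_integral_unique)
  qed
  \<comment> \<open>The constant part bounds \<open>lam * \<bar>d t\<bar>\<close> through
    \<open>ftc\<close>; the singular part is the Abel kernel with its factor
    \<open>1 / Gamma (1/2)\<close>. Both are divided by \<open>n2\<close>.\<close>
  define K where "K u = lam / n2 + n1 / (n2 * sqrt pi) * (1 / sqrt u)" for u
  have Kpos: "K u \<ge> 0" if "u \<ge> 0" for u using that lam n1 n2 by (simp add: K_def)
  \<comment> \<open>The absolute value makes the kernel nonnegative on the whole line, as
    \<open>sqrt\<close> is negative at negative arguments.\<close>
  have null: "AE t in lborel. indicator {0<..<T} t * \<bar>d' t\<bar> = 0" if T: "T > 0" for T
  proof (rule volterra_inequality_imp_null[where K = "\<lambda>u. \<bar>K u\<bar>"])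
    show "integrable lborel (\<lambda>t. indicator {0<..<T} t * \<bar>d' t\<bar>)"
      using integrable_abs[OF int'[OF T]] by (simp add: abs_mult)
    have "integrable lborel (\<lambda>u. lam / n2 * indicator {0<..<T} u
        + n1 / (n2 * sqrt pi) * (indicator {0<..<T} u * (1 / sqrt u)))"
      by (intro Bochner_Integration.integrable_add integrable_mult_right integrable_inverse_sqrt)
        (use T in auto)
    then have "integrable lborel (\<lambda>u. indicator {0<..<T} u * K u)"
      by (simp add: K_def algebra_simps)
    from integrable_abs[OF this] show "integrable lborel (\<lambda>u. indicator {0<..<T} u * \<bar>K u\<bar>)"
      by (simp add: abs_mult)
    fix t assume "t \<in> {0<..<T}"
    then have t: "t > 0" by simp
    let ?k = "\<lambda>s. indicator {0<..<t} s * ((t - s) powr (-1/2) * d' s)"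
    have "n2 * d' t = - lam * d t - n1 / sqrt pi * integral\<^sup>L lborel ?k"
      using eq[OF t] by simp
    then have "n2 * \<bar>d' t\<bar> = \<bar>- lam * d t - n1 / sqrt pi * integral\<^sup>L lborel ?k\<bar>"
      using n2 by (metis abs_mult abs_of_pos)
    also have "\<dots> \<le> lam * \<bar>d t\<bar> + n1 / sqrt pi * \<bar>integral\<^sup>L lborel ?k\<bar>"
      using abs_triangle_ineq4[of "- lam * d t" "n1 / sqrt pi * integral\<^sup>L lborel ?k"] lam n1
      by (simp add: abs_mult)
    also have "\<dots> \<le> lam * (LBINT s. indicator {0<..<t} s * \<bar>d' s\<bar>) + n1 / sqrt pi * (LBINT s. \<bar>?k s\<bar>)"
    proof (intro add_mono mult_left_mono)
      show "\<bar>d t\<bar> \<le> (LBINT s. indicator {0<..<t} s * \<bar>d' s\<bar>)"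
        using integral_abs_bound[of lborel "\<lambda>s. indicator {0<..<t} s * d' s"]
        by (simp add: ftc[OF t] abs_mult)
    qed (use lam n1 integral_abs_bound in auto)
    finally have "\<bar>d' t\<bar> \<le> (lam * (LBINT s. indicator {0<..<t} s * \<bar>d' s\<bar>) + n1 / sqrt pi * (LBINT s. \<bar>?k s\<bar>)) / n2"
      using n2 by (simp add: abs_mult pos_le_divide_eq mult.commute)
    also have "\<dots> = (LBINT s. (lam / n2 * (indicator {0<..<t} s * \<bar>d' s\<bar>) + n1 / (n2 * sqrt pi) * \<bar>?k s\<bar>))"
      using integrable_abs[OF int'[OF t]] integrable_abs[OF int[OF t]] n2
      by (subst Bochner_Integration.integral_add) (auto simp: abs_mult field_simps)
    also have "(\<lambda>s. (lam / n2 * (indicator {0<..<t} s * \<bar>d' s\<bar>) + n1 / (n2 * sqrt pi) * \<bar>?k s\<bar>))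
        = (\<lambda>s. indicator {0<..<t} s * (\<bar>K (t - s)\<bar> * \<bar>d' s\<bar>))"
    proof
      fix s
      show "lam / n2 * (indicator {0<..<t} s * \<bar>d' s\<bar>) + n1 / (n2 * sqrt pi) * \<bar>?k s\<bar>
        = indicator {0<..<t} s * (\<bar>K (t - s)\<bar> * \<bar>d' s\<bar>)"
      proof (cases "s \<in> {0<..<t}")
        case True
        then have "K (t - s) \<ge> 0" by (intro Kpos) simp
        then have K: "\<bar>K (t - s)\<bar> = lam / n2 + n1 / (n2 * sqrt pi) * (1 / sqrt (t - s))"
          by (simp add: K_def)
        have p: "\<bar>(t - s) powr (-1/2)\<bar> = 1 / sqrt (t - s)"
          using powr_minus_half[of "t - s"] True by simp
        have "\<bar>?k s\<bar> = 1 / sqrt (t - s) * \<bar>d' s\<bar>"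
          using True by (simp only: abs_mult p) simp
        then show ?thesis unfolding K using True by (simp add: distrib_right)
      qed simp
    qed
    finally have le: "\<bar>d' t\<bar> \<le> (LBINT s. indicator {0<..<t} s * (\<bar>K (t - s)\<bar> * \<bar>d' s\<bar>))" .
    show "ennreal \<bar>d' t\<bar> \<le> (\<integral>\<^sup>+ s. ennreal (indicator {0<..<t} s * (\<bar>K (t - s)\<bar> * \<bar>d' s\<bar>)) \<partial>lborel)"
    \<comment> \<open>Without integrability the Bochner integral is 0 by convention, and
      \<open>le\<close> then forces \<open>d' t = 0\<close>.\<close>
    proof (cases "integrable lborel (\<lambda>s. indicator {0<..<t} s * (\<bar>K (t - s)\<bar> * \<bar>d' s\<bar>))")
      case True
      then show ?thesis using le by (subst nn_integral_eq_integral) (auto intro: ennreal_leI)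
    next
      case False
      then show ?thesis using le by (simp add: not_integrable_integral_eq)
    qed
  qed auto
  show ?thesis
  proof (cases "t0 = 0")
    case True
    then show ?thesis using d0 by (simp add: d_def)
  next
    case False
    then have t0: "t0 > 0" using t0 by simp
    have "d t0 = integral\<^sup>L lborel (\<lambda>_::real. 0)"
      unfolding ftc[OF t0]
      by (rule integral_cong_AE)
        (use null[OF t0] borel_measurable_integrable[OF int'[OF t0]] in \<open>auto elim!: eventually_mono\<close>)
    then show ?thesis by (simp add: d_def)
  qed
qed

section \<open>Probabilistic representation\<close>

text \<open>For \<open>t > 0\<close> derivatives see only values near \<open>t\<close>, and the
  Caputo integral sees derivatives on \<open>0 < s < t\<close>. This lets the probability replace
  \<open>relax\<close>, with which it is compared at nonnegative times.\<close>

lemma relaxation_solution_cong: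
  assumes f: "relaxation_solution lam n1 n2 f" and eq: "\<And>t. t \<ge> 0 \<Longrightarrow> g t = f t"
  shows "relaxation_solution lam n1 n2 g"
proof -
  have ev: "\<forall>\<^sub>F s in nhds t. f s = g s" if "t > 0" for t :: real
    using eventually_nhds_in_open[of "{0<..}" t] that by (auto elim!: eventually_mono simp: eq)
  have d: "deriv g t = deriv f t" if "t > 0" for t
    using deriv_cong_ev[OF ev[OF that] refl] by simp
  have fd: "g field_differentiable (at t) \<longleftrightarrow> f field_differentiable (at t)" if "t > 0" for t
    unfolding field_differentiable_def using DERIV_cong_ev[OF refl ev[OF that] refl] by blast
  have caputo: "caputo_half_exists g t \<longleftrightarrow> caputo_half_exists f t" "caputo_half g t = caputo_half f t" for t
  proof -
    have *: "(\<lambda>s. indicator {0<..<t} s *\<^sub>R ((t - s) powr (-1/2) * deriv g s))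
       = (\<lambda>s. indicator {0<..<t} s *\<^sub>R ((t - s) powr (-1/2) * deriv f s))"
      by (auto simp: fun_eq_iff indicator_def d)
    show "caputo_half_exists g t \<longleftrightarrow> caputo_half_exists f t" "caputo_half g t = caputo_half f t"
      unfolding caputo_half_exists_def caputo_half_def set_integrable_def set_lebesgue_integral_def *
      by (auto simp: fd)
  qed
  have "continuous_on {0..} g"
    using f by (subst continuous_on_cong[OF refl, of _ g f]) (auto simp: eq relaxation_solution_def)
  then show ?thesis
    using f by (auto simp: relaxation_solution_def fd d caputo eq)
qed

text \<open>\<open>T t\<close> is the path followed by evaluation at \<open>t\<close>, so its events
  are events of the path and inherit independence.\<close>

lemma relaxation_process_indep_var:
  assumes proc: "relaxation_process lam n1 n2 M T U" and t: "t \<ge> 0"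
  shows "prob_space.indep_var M borel (T t) borel U"
proof -
  interpret prob_space M using proc by (simp add: relaxation_process_def)
  let ?f = "\<lambda>\<omega>. \<lambda>t\<in>{0..}. T t \<omega>"
  let ?N = "PiM {0..} (\<lambda>_. borel) :: (real \<Rightarrow> real) measure"
  have T: "T t \<in> borel_measurable M" and U: "U \<in> borel_measurable M"
    using proc t by (auto simp: relaxation_process_def distributed_def)
  have "{T t -` A \<inter> space M |A. A \<in> sets borel} \<subseteq> sets (vimage_algebra (space M) ?f ?N)"
  proof safe
    fix A :: "real set" assume A: "A \<in> sets borel"
    have "(\<lambda>x. x t) -` A \<inter> space ?N \<in> sets ?N"
      by (rule measurable_sets[where A = borel])
        (use t A in \<open>auto intro: measurable_component_singleton\<close>)
    then have "?f -` ((\<lambda>x. x t) -` A \<inter> space ?N) \<inter> space M \<in> sets (vimage_algebra (space M) ?f ?N)"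
      by (rule in_vimage_algebra)
    also have "?f -` ((\<lambda>x. x t) -` A \<inter> space ?N) \<inter> space M = T t -` A \<inter> space M"
      using t by (auto simp: space_PiM)
    finally show "T t -` A \<inter> space M \<in> sets (vimage_algebra (space M) ?f ?N)" .
  qed
  then have "sigma_sets (space M) {T t -` A \<inter> space M |A. A \<in> sets borel} \<subseteq> sets (vimage_algebra (space M) ?f ?N)"
    using sets.sigma_sets_subset[of _ "vimage_algebra (space M) ?f ?N"] by simp
  moreover have "indep_set (sets (vimage_algebra (space M) ?f ?N)) (sets (vimage_algebra (space M) U borel))"
    using proc by (simp add: relaxation_process_def)
  ultimately have "indep_set (sigma_sets (space M) {T t -` A \<inter> space M |A. A \<in> sets borel})
      (sets (vimage_algebra (space M) U borel))"
    unfolding indep_sets2_eq by blast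
  then show ?thesis
    unfolding indep_var_eq using T U by (simp add: sets_vimage_algebra)
qed

text \<open>Fubini for the product law of \<open>T t\<close> and \<open>U\<close>: at
  \<open>T t = y\<close> the exponential tail contributes \<open>exp (- lam * y)\<close>, leaving
  the Laplace transform of the density. Time 0 is separate because \<open>T 0\<close> has an
  atom.\<close>

lemma relaxation_process_prob:
  assumes lam: "lam > 0" and n1: "n1 > 0" and n2: "n2 > 0"
    and proc: "relaxation_process lam n1 n2 M T U" and t: "t \<ge> 0"
  shows "\<P>(\<omega> in M. T t \<omega> < U \<omega>) = relax lam n1 n2 t"
proof -
  interpret prob_space M using proc by (simp add: relaxation_process_def)
  have U: "distributed M lborel U (\<lambda>y. ennreal (exponential_density lam y))"
    using proc by (simp add: relaxation_process_def)
  have [measurable]: "T t \<in> borel_measurable M" "U \<in> borel_measurable M"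
    using proc t by (auto simp: relaxation_process_def distributed_def)
  have tail: "\<P>(\<omega> in M. y < U \<omega>) = exp (- y * lam)" if "y \<ge> 0" for y
    using exponential_distributedD_gt[OF U that lam] .
  show ?thesis
  proof (cases "t = 0")
    case True
    have "AE \<omega> in M. T 0 \<omega> = 0" using proc by (simp add: relaxation_process_def)
    then have "AE \<omega> in M. T t \<omega> < U \<omega> \<longleftrightarrow> 0 < U \<omega>" using True by auto
    then have "\<P>(\<omega> in M. T t \<omega> < U \<omega>) = \<P>(\<omega> in M. 0 < U \<omega>)"
      by (intro finite_measure_eq_AE) auto
    then show ?thesis using tail[of 0] relax_0[OF lam n1 n2] True by simp
  next
    case False
    with t have t: "t > 0" by simp
    have Td: "distributed M lborel (T t) (\<lambda>y. ennreal (q_half_one n1 n2 y t))"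
      using proc t by (simp add: relaxation_process_def)
    have DT: "distr M borel (T t) = density lborel (\<lambda>y. ennreal (q_half_one n1 n2 y t))"
      using distributed_distr_eq_density[OF Td] by (simp cong: distr_cong)
    have indep: "distr M borel (T t) \<Otimes>\<^sub>M distr M borel U = distr M (borel \<Otimes>\<^sub>M borel) (\<lambda>\<omega>. (T t \<omega>, U \<omega>))"
      using relaxation_process_indep_var[OF proc, of t] t by (simp add: indep_var_distribution_eq)
    interpret DU: prob_space "distr M borel U" by (rule prob_space_distr) simp
    let ?A = "{p :: real \<times> real. fst p < snd p}"
    have A: "?A \<in> sets (borel \<Otimes>\<^sub>M borel)"
      unfolding borel_prod by (intro borel_open open_Collect_less continuous_intros)
    have "emeasure M {\<omega> \<in> space M. T t \<omega> < U \<omega>} = emeasure (distr M borel (T t) \<Otimes>\<^sub>M distr M borel U) ?A"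
      unfolding indep using A by (subst emeasure_distr) (auto intro!: arg_cong[where f = "emeasure M"])
    also have "\<dots> = (\<integral>\<^sup>+ y. emeasure (distr M borel U) (Pair y -` ?A) \<partial>distr M borel (T t))"
      using A by (intro DU.emeasure_pair_measure_alt) (simp cong: sets_pair_measure_cong)
    also have "\<dots> = (\<integral>\<^sup>+ y. emeasure M {\<omega> \<in> space M. y < U \<omega>} \<partial>distr M borel (T t))"
      by (intro nn_integral_cong, subst emeasure_distr)
        (auto intro!: arg_cong[where f = "emeasure M"] simp: vimage_def)
    also have "\<dots> = (\<integral>\<^sup>+ y. ennreal (q_half_one n1 n2 y t) * emeasure M {\<omega> \<in> space M. y < U \<omega>} \<partial>lborel)"
      unfolding DT by (rule nn_integral_density) (use n1 n2 in \<open>auto simp: measurable_q_half_one\<close>)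
    also have "\<dots> = (\<integral>\<^sup>+ y. ennreal (q_half_one n1 n2 y t) * ennreal (exp (- lam * y)) \<partial>lborel)"
    proof (rule nn_integral_cong)
      fix y
      \<comment> \<open>For \<open>y \<le> 0\<close> the density is 0 and both sides vanish.\<close>
      show "ennreal (q_half_one n1 n2 y t) * emeasure M {\<omega> \<in> space M. y < U \<omega>}
        = ennreal (q_half_one n1 n2 y t) * ennreal (exp (- lam * y))"
        using tail[of y] by (cases "y > 0") (auto simp: emeasure_eq_measure q_half_one_def mult.commute)
    qed
    also have "\<dots> = ennreal (relax lam n1 n2 t)"
      by (rule relax_nn_integral[OF lam n1 n2 t, symmetric])
    finally show ?thesis
      unfolding emeasure_eq_measure
      by (subst (asm) ennreal_inj) (auto simp: relax_def)
  qed
qed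

section \<open>Construction of the process\<close>

text \<open>One half-normal variable, coordinate 0 of the first factor, drives the path at all
  times, and \<open>U\<close> is the second factor. Independence of \<open>U\<close> from the whole
  path is then that of the factors of a product measure.\<close>

lemma relaxation_process_exists:
  fixes lam n1 n2 :: real
  assumes lam: "lam > 0" and n1: "n1 > 0" and n2: "n2 > 0"
  shows "\<exists>(M :: ((real \<Rightarrow> real) \<times> real) measure) T U. relaxation_process lam n1 n2 M T U"
proof -
  let ?P = "PiM UNIV (\<lambda>_. half_normal) :: (real \<Rightarrow> real) measure"
  let ?E = "density lborel (\<lambda>y. ennreal (exponential_density lam y))"
  define M where "M = ?P \<Otimes>\<^sub>M ?E"
  define T where "T t \<omega> = passage n1 n2 t (fst \<omega> 0)" for t and \<omega> :: "(real \<Rightarrow> real) \<times> real"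
  interpret HN: prob_space half_normal by (rule prob_space_half_normal)
  interpret P: prob_space ?P by (rule prob_space_PiM) (rule prob_space_half_normal)
  interpret E: prob_space ?E by (rule prob_space_exponential_density) (rule lam)
  interpret PE: pair_prob_space ?P ?E ..
  have M: "prob_space M" unfolding M_def by (rule PE.prob_space_axioms)
  interpret M: prob_space M by (rule M)
  have spM: "space M = UNIV" by (simp add: M_def space_pair_measure space_PiM)
  have sets_M [measurable_cong]: "sets M = sets (?P \<Otimes>\<^sub>M borel)"
    unfolding M_def by (rule sets_pair_measure_cong) auto
  have Z [measurable]: "(\<lambda>\<omega>. fst \<omega> 0) \<in> M \<rightarrow>\<^sub>M half_normal"
    unfolding M_def by measurable
  have "distr M ?P fst = ?P" unfolding M_def by (rule E.distr_pair_fst)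
  then have "distr M half_normal (\<lambda>\<omega>. fst \<omega> 0) = distr ?P half_normal (\<lambda>\<omega>. \<omega> 0)"
    using distr_distr[of "\<lambda>\<omega>. \<omega> 0" ?P half_normal fst M] by (simp add: o_def M_def)
  also have "\<dots> = half_normal" by (rule distr_PiM_component) (auto intro: prob_space_half_normal)
  finally have DZ: "distr M half_normal (\<lambda>\<omega>. fst \<omega> 0) = half_normal" .
  have mp: "passage n1 n2 t \<in> borel_measurable half_normal" for t by measurable
  have mT [measurable]: "T t \<in> borel_measurable M" for t
    unfolding T_def[abs_def] by measurable
  have DT: "distr M borel (T t) = density lborel (\<lambda>y. ennreal (q_half_one n1 n2 y t))" if "t > 0" for t
  proof -
    have "distr M borel (T t) = distr half_normal borel (passage n1 n2 t)"
      using distr_distr[OF mp Z, of t] by (simp add: DZ o_def T_def[abs_def])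
    then show ?thesis by (simp add: distr_passage[OF n1 n2 that])
  qed
  have DU: "distr M lborel snd = ?E"
  proof (rule measure_eqI)
    fix A assume "A \<in> sets (distr M lborel snd)"
    then have A: "A \<in> sets borel" by simp
    have "emeasure (distr M lborel snd) A = emeasure M (UNIV \<times> A)"
    proof -
      have "snd -` A = (UNIV :: (real \<Rightarrow> real) set) \<times> A" by auto
      then show ?thesis using A spM by (subst emeasure_distr) (auto simp: M_def)
    qed
    also have "\<dots> = emeasure ?P UNIV * emeasure ?E A"
      unfolding M_def using A P.emeasure_space_1 E.emeasure_pair_measure_Times[of UNIV ?P A] sets.top[of ?P]
      by (simp add: space_PiM)
    also have "\<dots> = emeasure ?E A" using P.emeasure_space_1 by (simp add: space_PiM)
    finally show "emeasure (distr M lborel snd) A = emeasure ?E A" .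
  qed simp
  have "relaxation_process lam n1 n2 M T snd"
    unfolding relaxation_process_def
  proof (intro conjI allI impI M mT)
    show "distributed M lborel snd (\<lambda>y. ennreal (exponential_density lam y))"
      unfolding distributed_def using DU by (auto simp: M_def)
    show "distributed M lborel (T t) (\<lambda>y. ennreal (q_half_one n1 n2 y t))" if "t > 0" for t
      unfolding distributed_def using DT[OF that] n1 n2
      by (auto simp: measurable_q_half_one cong: distr_cong)
    have "AE z in distr M half_normal (\<lambda>\<omega>. fst \<omega> 0). passage n1 n2 0 z = 0"
      unfolding DZ using AE_half_normal_pos by eventually_elim (simp add: n2)
    from AE_distrD[OF Z this] show "AE \<omega> in M. T 0 \<omega> = 0" by (simp add: T_def)
    let ?f = "\<lambda>\<omega>. \<lambda>t\<in>{0..}. T t \<omega>"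
    let ?N = "PiM {0..} (\<lambda>_. borel) :: (real \<Rightarrow> real) measure"
    define G where "G x = (\<lambda>t\<in>{0..}. passage n1 n2 t (x 0))" for x :: "real \<Rightarrow> real"
    have G: "G \<in> ?P \<rightarrow>\<^sub>M ?N"
      unfolding G_def by (rule measurable_restrict) measurable
    have f: "?f \<omega> = G (fst \<omega>)" for \<omega> by (simp add: G_def T_def)
    show "M.indep_set (sets (vimage_algebra (space M) ?f ?N)) (sets (vimage_algebra (space M) snd borel))"
      unfolding M.indep_sets2_eq
    proof (intro conjI ballI)
      \<comment> \<open>The path is the function \<open>G\<close> of the first component, so its
        events are cylinders over the first factor; those of \<open>U\<close> are cylinders over the
        second. Their intersections are rectangles, where the measure factorises.\<close>
      have a: "\<exists>A\<in>sets ?P. a = A \<times> UNIV" if "a \<in> sets (vimage_algebra (space M) ?f ?N)" for a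
      proof -
        have *: "?f \<in> space M \<rightarrow> space ?N" by (auto simp: space_PiM)
        have "a \<in> {?f -` B \<inter> space M |B. B \<in> sets ?N}"
          using that by (simp only: sets_vimage_algebra2[OF *])
        then obtain B where B: "B \<in> sets ?N" "a = ?f -` B \<inter> space M"
          by (elim CollectE exE conjE) (rule that)
        have "a = (G -` B \<inter> space ?P) \<times> UNIV"
          unfolding B(2) f spM by (auto simp: space_PiM)
        then show ?thesis using measurable_sets[OF G B(1)] by blast
      qed
      have b: "\<exists>B\<in>sets borel. b = UNIV \<times> B" if "b \<in> sets (vimage_algebra (space M) snd borel)" for b
      proof -
        have *: "snd \<in> space M \<rightarrow> space borel" by simp
        have "b \<in> {snd -` B \<inter> space M |B. B \<in> sets borel}"
          using that by (simp only: sets_vimage_algebra2[OF *])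
        then obtain B where "B \<in> sets borel" "b = snd -` B \<inter> space M"
          by (elim CollectE exE conjE) (rule that)
        then show ?thesis by (intro bexI[of _ B]) (auto simp: spM)
      qed
      have tP: "UNIV \<in> sets ?P" using sets.top[of ?P] by (simp add: space_PiM)
      show "sets (vimage_algebra (space M) ?f ?N) \<subseteq> M.events"
      proof
        fix a assume "a \<in> sets (vimage_algebra (space M) ?f ?N)"
        from a[OF this] show "a \<in> M.events" by (auto simp: M_def)
      qed
      show "sets (vimage_algebra (space M) snd borel) \<subseteq> M.events"
      proof
        fix b assume "b \<in> sets (vimage_algebra (space M) snd borel)"
        from b[OF this] show "b \<in> M.events" using tP by (auto simp: M_def)
      qed
      fix a b assume ab: "a \<in> sets (vimage_algebra (space M) ?f ?N)" "b \<in> sets (vimage_algebra (space M) snd borel)"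
      from a[OF ab(1)] obtain A where A: "A \<in> sets ?P" "a = A \<times> UNIV" by auto
      from b[OF ab(2)] obtain B where B: "B \<in> sets borel" "b = UNIV \<times> B" by auto
      have times: "emeasure M (X \<times> Y) = emeasure ?P X * emeasure ?E Y" if "X \<in> sets ?P" "Y \<in> sets borel" for X Y
        unfolding M_def using that by (intro E.emeasure_pair_measure_Times) auto
      have 1: "emeasure ?P UNIV = 1" "emeasure ?E UNIV = 1"
        using P.emeasure_space_1 E.emeasure_space_1 by (auto simp: space_PiM)
      have "a \<inter> b = A \<times> B" using A B by auto
      then show "M.prob (a \<inter> b) = M.prob a * M.prob b"
        using A B tP by (simp add: measure_def times 1 enn2real_mult)
    qed
  qed
  then show ?thesis by blast
qed

theorem theorem3p2:
  fixes lam n1 n2 :: real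
  assumes "lam > 0" and "n1 > 0" and "n2 > 0" and "n1 + n2 = 1"
  shows
    "(\<exists>(M :: ((real \<Rightarrow> real) \<times> real) measure) T U. relaxation_process lam n1 n2 M T U) \<and>
     (\<forall>(M :: 'w measure) T U. relaxation_process lam n1 n2 M T U \<longrightarrow>
        relaxation_solution lam n1 n2 (\<lambda>t. \<P>(\<omega> in M. T t \<omega> < U \<omega>)) \<and>
        (\<forall>\<psi>. relaxation_solution lam n1 n2 \<psi> \<longrightarrow>
           (\<forall>t\<ge>0. \<psi> t = \<P>(\<omega> in M. T t \<omega> < U \<omega>)))) \<and>
     (\<forall>y>0. \<forall>t>0.
        (\<lambda>s. q_half_one n1 n2 y s) field_differentiable (at t) \<and>
        (\<lambda>x. q_half_one n1 n2 x t) field_differentiable (at y) \<and>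
        caputo_half_exists (\<lambda>s. q_half_one n1 n2 y s) t \<and>
        n1 * caputo_half (\<lambda>s. q_half_one n1 n2 y s) t
          + n2 * deriv (\<lambda>s. q_half_one n1 n2 y s) t
          = - deriv (\<lambda>x. q_half_one n1 n2 x t) y) \<and>
     delta_initial (q_half_one n1 n2)"
proof (intro conjI allI impI)
  note pos = assms(1-3)
  show "\<exists>(M :: ((real \<Rightarrow> real) \<times> real) measure) T U. relaxation_process lam n1 n2 M T U"
    by (rule relaxation_process_exists[OF pos])
  show "delta_initial (q_half_one n1 n2)" by (rule delta_initial_q[OF pos(2,3)])
next
  fix M :: "'w measure" and T U
  assume proc: "relaxation_process lam n1 n2 M T U"
  note prob = relaxation_process_prob[OF assms(1-3) proc]
  show sol: "relaxation_solution lam n1 n2 (\<lambda>t. \<P>(\<omega> in M. T t \<omega> < U \<omega>))"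
    by (rule relaxation_solution_cong[OF relaxation_solution_relax[OF assms(1-3)] prob])
  fix \<psi> and t :: real
  assume "relaxation_solution lam n1 n2 \<psi>" and "t \<ge> 0"
  then show "\<psi> t = \<P>(\<omega> in M. T t \<omega> < U \<omega>)"
    by (rule relaxation_solution_unique[OF assms(1-3) _ sol])
next
  fix y t :: real assume y: "y > 0"
  note dt = q_half_one_deriv_time[OF assms(2,3) y, of t]
  note dy = q_half_one_deriv_space[OF assms(2,3) y, of t]
  note caputo = q_half_one_caputo[OF assms(2,3) y, of t]
  show "(\<lambda>s. q_half_one n1 n2 y s) field_differentiable (at t)"
    "(\<lambda>x. q_half_one n1 n2 x t) field_differentiable (at y)"
    using dt dy by (auto simp: field_differentiable_def)
  show "caputo_half_exists (\<lambda>s. q_half_one n1 n2 y s) t" by (rule caputo)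
  show "n1 * caputo_half (\<lambda>s. q_half_one n1 n2 y s) t + n2 * deriv (\<lambda>s. q_half_one n1 n2 y s) t
      = - deriv (\<lambda>x. q_half_one n1 n2 x t) y"
    \<comment> \<open>Both sides are the kernel combination with coefficients \<open>n1^2\<close>,
      \<open>2 * n1 * n2\<close>, \<open>n2^2\<close> at \<open>levy_density\<close>,
      \<open>abel_gauss'\<close>, \<open>levy_density'\<close>: the mixed term arises once from the
      Caputo part and once from the time derivative.\<close>
    unfolding caputo(2) DERIV_imp_deriv[OF dt] DERIV_imp_deriv[OF dy]
    by (simp add: algebra_simps power2_eq_square)
qed

end
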